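(* Let $\mu>0$, $m>0$, $\varepsilon>0$, and let $(S,Z)\in H^1_r(\mathbb R^3)\times D^1_r(\mathbb R^3)$ be a solution of the system $$\Delta S-S=SZ,\qquad \Delta Z=\mu S^2,\qquad S\to0\ \text{ and }\ Z\to0\ \text{ as }\ \xi\to\infty.$$ Set $\xi=\varepsilon m r$. Then, for any $\alpha<1$, $$S(\xi)=O\bigl(e^{-\alpha\varepsilon m r}\bigr)\quad\text{as } r\to\infty,$$ and $$r\,Z(\xi)\to-\frac{M}{\varepsilon m}\quad\text{as } r\to\infty,\qquad\text{where}\quad M=\mu\int_0^\infty y^2S^2(y)\,dy .$$ In addition, $S\sqrt\mu$ is independent of $\mu$, in the sense that $(S,Z)$ solves the system with parameter $\mu$ if and only if $(\sqrt\mu\,S,Z)$ solves the same system with $\mu$ replaced by $1$.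
   Context: Functions of $\xi\ge0$ are identified with radial functions on $\mathbb R^3$, with $\xi=|x|$. $\Delta=\frac{d^2}{d\xi^2}+\frac2\xi\frac{d}{d\xi}$ is the radial Laplacian in three dimensions (solutions are understood as solutions on all of $\mathbb R^3$, e.g. in the sense of distributions, where $\Delta$ is the Laplacian of $\mathbb R^3$). $H^1_r(\mathbb R^3)$ is the space of radial real-valued functions on $\mathbb R^3$ that are square-integrable together with their first-order derivatives. $D^1_r(\mathbb R^3)$ is the closure of the set of smooth, compactly supported, radial real-valued functions for the norm $\|\nabla u\|_{L^2}$; equivalently, it is the space of radial functions in $L^6(\mathbb R^3)$ with square-integrable first-order derivatives. *)

theory Defs
  imports "HOL-Analysis.Analysis" "HOL-Library.Landau_Symbols"
begin

section \<open>Test functions\<close>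

definition partial :: "'a::euclidean_space \<Rightarrow> ('a \<Rightarrow> real) \<Rightarrow> 'a \<Rightarrow> real" where
  "partial b f x = frechet_derivative f (at x) b"

primrec C_k :: "nat \<Rightarrow> ('a::euclidean_space \<Rightarrow> real) \<Rightarrow> bool" where
  "C_k 0 f \<longleftrightarrow> continuous_on UNIV f"
| "C_k (Suc k) f \<longleftrightarrow> (\<forall>x. f differentiable (at x)) \<and> (\<forall>b\<in>Basis. C_k k (partial b f))"

definition test_fun :: "('a::euclidean_space \<Rightarrow> real) \<Rightarrow> bool" where
  "test_fun \<phi> \<longleftrightarrow> (\<forall>k. C_k k \<phi>) \<and> compact (closure {x. \<phi> x \<noteq> 0})"

definition laplacian :: "('a::euclidean_space \<Rightarrow> real) \<Rightarrow> 'a \<Rightarrow> real" where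
  "laplacian \<phi> x = (\<Sum>b\<in>Basis. partial b (partial b \<phi>) x)"


section \<open>Weak derivatives\<close>

text \<open>
  Functions on the whole space are Borel measurable representatives of their classes modulo
  null sets; every Lebesgue class contains one.
\<close>

definition loc_integrable :: "('a::euclidean_space \<Rightarrow> real) \<Rightarrow> bool" where
  "loc_integrable u \<longleftrightarrow> u \<in> borel_measurable borel \<and> (\<forall>K. compact K \<longrightarrow> set_integrable lborel K u)"

definition weak_partial :: "'a::euclidean_space \<Rightarrow> ('a \<Rightarrow> real) \<Rightarrow> ('a \<Rightarrow> real) \<Rightarrow> bool" where
  "weak_partial b u g \<longleftrightarrow> loc_integrable u \<and> loc_integrable g \<and>
     (\<forall>\<phi>. test_fun \<phi> \<longrightarrow> (LINT x|lborel. u x * partial b \<phi> x) = - (LINT x|lborel. g x * \<phi> x))"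

definition weak_laplacian :: "('a::euclidean_space \<Rightarrow> real) \<Rightarrow> ('a \<Rightarrow> real) \<Rightarrow> bool" where
  "weak_laplacian u f \<longleftrightarrow> loc_integrable u \<and> loc_integrable f \<and>
     (\<forall>\<phi>. test_fun \<phi> \<longrightarrow> (LINT x|lborel. u x * laplacian \<phi> x) = (LINT x|lborel. f x * \<phi> x))"


section \<open>Function spaces\<close>

definition Lp :: "nat \<Rightarrow> ('a::euclidean_space \<Rightarrow> real) set" where
  "Lp p = {u. u \<in> borel_measurable borel \<and> integrable lborel (\<lambda>x. \<bar>u x\<bar> ^ p)}"

definition L2_gradient :: "('a::euclidean_space \<Rightarrow> real) \<Rightarrow> bool" where
  "L2_gradient u \<longleftrightarrow> (\<forall>b\<in>Basis. \<exists>g\<in>Lp 2. weak_partial b u g)"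

definition rad3 :: "(real \<Rightarrow> real) \<Rightarrow> real^3 \<Rightarrow> real" where
  "rad3 u x = u (norm x)"

text \<open>Only the values of the profiles on \<open>[0,\<infinity>)\<close> matter.\<close>

definition H1r :: "(real \<Rightarrow> real) set" where
  "H1r = {u. rad3 u \<in> Lp 2 \<and> L2_gradient (rad3 u)}"

text \<open>
  The exponent 6 is the critical Sobolev exponent in dimension 3: this is the concrete realisation
  of the completion of the radial test functions for the norm \<open>\<parallel>\<nabla>u\<parallel>\<close> of \<open>L\<^sup>2\<close>.
\<close>

definition D1r :: "(real \<Rightarrow> real) set" where
  "D1r = {u. rad3 u \<in> Lp 6 \<and> L2_gradient (rad3 u)}"


section \<open>Behaviour at infinity of functions defined modulo null sets\<close>

text \<open>
  Elements of \<^const>\<open>H1r\<close> and \<^const>\<open>D1r\<close> may be changed on null sets, so their behaviour at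
  infinity is taken modulo null sets. For the representatives that are continuous away
  from the origin this is the ordinary behaviour at infinity, as the lemmas below show.
\<close>

definition ess_at_top :: "real filter" where
  "ess_at_top = inf at_top (ae_filter lborel)"

lemma eventually_ess_at_top:
  "eventually P ess_at_top \<longleftrightarrow> (\<exists>N. AE x in lborel. x \<ge> N \<longrightarrow> P x)"
proof
  assume "eventually P ess_at_top"
  then obtain Q R where Q: "eventually Q at_top" and R: "AE x in lborel. R x"
    and P: "\<And>x. Q x \<Longrightarrow> R x \<Longrightarrow> P x"
    by (auto simp: ess_at_top_def eventually_inf)
  from Q obtain N where "\<And>x. x \<ge> N \<Longrightarrow> Q x"
    by (auto simp: eventually_at_top_linorder)
  with R P have "AE x in lborel. x \<ge> N \<longrightarrow> P x"
    by auto
  then show "\<exists>N. AE x in lborel. x \<ge> N \<longrightarrow> P x" ..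
next
  assume "\<exists>N. AE x in lborel. x \<ge> N \<longrightarrow> P x"
  then obtain N where N: "AE x in lborel. x \<ge> N \<longrightarrow> P x" ..
  show "eventually P ess_at_top"
    unfolding ess_at_top_def eventually_inf
    by (rule exI[of _ "\<lambda>x. x \<ge> N"], rule exI[of _ "\<lambda>x. x \<ge> N \<longrightarrow> P x"])
      (use N in \<open>auto intro: eventually_ge_at_top\<close>)
qed

lemma eventually_ess_at_top_iff_at_top:
  assumes "open {x. 0 < x \<and> \<not> P x}"
  shows "eventually P ess_at_top \<longleftrightarrow> eventually P at_top"
proof
  assume "eventually P at_top"
  then show "eventually P ess_at_top"
    unfolding ess_at_top_def by (rule filter_leD[OF inf_le1])
next
  assume "eventually P ess_at_top"
  then obtain N where N: "AE x in lborel. x \<ge> N \<longrightarrow> P x"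
    by (auto simp: eventually_ess_at_top)
  define U where "U = {x. 0 < x \<and> \<not> P x} \<inter> {N<..}"
  have "open U"
    using assms by (auto simp: U_def)
  moreover have "AE x in lebesgue. x \<notin> U"
    using AE_completion[OF N] by (auto simp: U_def)
  then have "negligible U"
    using \<open>open U\<close> by (simp add: negligible_iff_null_sets AE_iff_null_sets borel_open)
  ultimately have "U = {}"
    using open_not_negligible by blast
  then have "P x" if "x > max 0 N" for x
    using that by (auto simp: U_def)
  then show "eventually P at_top"
    using eventually_gt_at_top[of "max 0 N"] by (auto elim: eventually_mono)
qed

lemma ess_at_top_neq_bot: "ess_at_top \<noteq> bot"
proof -
  have "open {x::real. 0 < x \<and> \<not> False}"
    using open_greaterThan[of "0::real"] by (simp add: greaterThan_def)
  from eventually_ess_at_top_iff_at_top[OF this] show ?thesis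
    by (simp flip: trivial_limit_def add: trivial_limit_at_top_linorder)
qed

lemma open_pos_less:
  fixes f g :: "real \<Rightarrow> real"
  assumes "continuous_on {0<..} f" and "continuous_on {0<..} g"
  shows "open {x. 0 < x \<and> f x < g x}"
proof -
  obtain A where "open A" "A \<inter> {0<..} = {x\<in>{0<..}. f x < g x}"
    using open_Collect_less_Int[OF assms] by blast
  moreover have "{x\<in>{0<..}. f x < g x} = {x. 0 < x \<and> f x < g x}"
    by auto
  ultimately show ?thesis
    by (metis open_Int open_greaterThan)
qed

lemma tendsto_ess_at_top_iff:
  fixes f :: "real \<Rightarrow> real"
  assumes "continuous_on {0<..} f"
  shows "(f \<longlongrightarrow> l) ess_at_top \<longleftrightarrow> (f \<longlongrightarrow> l) at_top"
proof
  assume "(f \<longlongrightarrow> l) at_top"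
  then show "(f \<longlongrightarrow> l) ess_at_top"
    unfolding ess_at_top_def by (rule tendsto_mono[OF inf_le1])
next
  assume lim: "(f \<longlongrightarrow> l) ess_at_top"
  show "(f \<longlongrightarrow> l) at_top"
  proof (rule tendstoI)
    fix e :: real
    assume "e > 0"
    have "open {x. 0 < x \<and> e / 2 < dist (f x) l}"
      using assms by (intro open_pos_less continuous_intros)
    then have "open {x. 0 < x \<and> \<not> dist (f x) l \<le> e / 2}"
      by (simp add: not_le)
    moreover have "eventually (\<lambda>x. dist (f x) l \<le> e / 2) ess_at_top"
      using tendstoD[OF lim, of "e / 2"] \<open>e > 0\<close> by (auto elim: eventually_mono)
    ultimately have "eventually (\<lambda>x. dist (f x) l \<le> e / 2) at_top"
      by (simp add: eventually_ess_at_top_iff_at_top)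
    then show "eventually (\<lambda>x. dist (f x) l < e) at_top"
      by (rule eventually_mono) (use \<open>e > 0\<close> in auto)
  qed
qed

lemma bigo_ess_at_top_iff:
  fixes f g :: "real \<Rightarrow> real"
  assumes "continuous_on {0<..} f" and "continuous_on {0<..} g"
  shows "f \<in> O[ess_at_top](g) \<longleftrightarrow> f \<in> O(g)"
proof -
  have "eventually (\<lambda>x. norm (f x) \<le> c * norm (g x)) ess_at_top
      \<longleftrightarrow> eventually (\<lambda>x. norm (f x) \<le> c * norm (g x)) at_top" for c
  proof (rule eventually_ess_at_top_iff_at_top)
    have "open {x. 0 < x \<and> c * norm (g x) < norm (f x)}"
      using assms by (intro open_pos_less continuous_intros)
    then show "open {x. 0 < x \<and> \<not> norm (f x) \<le> c * norm (g x)}"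
      by (simp add: not_le)
  qed
  then show ?thesis
    by (simp add: bigo_def)
qed


section \<open>The system\<close>

text \<open>The first equation is \<open>\<Delta>S - S = SZ\<close> with the term \<open>S\<close> moved to the right.\<close>

definition solution :: "real \<Rightarrow> (real \<Rightarrow> real) \<Rightarrow> (real \<Rightarrow> real) \<Rightarrow> bool" where
  "solution \<mu> S Z \<longleftrightarrow> S \<in> H1r \<and> Z \<in> D1r \<and>
     weak_laplacian (rad3 S) (rad3 (\<lambda>\<xi>. S \<xi> + S \<xi> * Z \<xi>)) \<and>
     weak_laplacian (rad3 Z) (rad3 (\<lambda>\<xi>. \<mu> * (S \<xi>)\<^sup>2)) \<and>
     (S \<longlongrightarrow> 0) ess_at_top \<and> (Z \<longlongrightarrow> 0) ess_at_top"

end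

theory Submission
  imports Defs
begin

text \<open>
  Testing \<open>\<Delta>U = F\<close> with radial functions \<open>\<psi>(|x|)\<close> that are constant near the origin, normalised by
  \<open>r\<^sup>2 \<psi>' = f\<close> with \<open>f\<close> an arbitrary test function on the open half-line, turns the weak equation into
  \<open>\<integral> U f' = - \<integral> (G / r\<^sup>2) f\<close> with \<open>G(r) = \<integral>\<^sub>0\<^sup>r y\<^sup>2 F\<close>; since \<open>\<psi>\<close> need not vanish at the origin, no
  free constant of integration appears. By the lemma of du Bois-Reymond, \<open>U\<close> agrees almost
  everywhere with a differentiable function \<open>u\<close> with \<open>u' = G / r\<^sup>2\<close>.

  For \<open>Z\<close> this reads \<open>r\<^sup>2 Z' = \<mu> \<integral>\<^sub>0\<^sup>r y\<^sup>2 S\<^sup>2 \<rightarrow> M\<close>, and integrating from infinity gives \<open>r Z \<rightarrow> -M\<close>.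
  For \<open>S\<close> it gives \<open>w'' = (1 + Z) w\<close> with \<open>w = r S\<close>; since \<open>1 + Z \<ge> \<alpha>\<^sup>2\<close> far out, comparison with
  \<open>e\<^bsup>-\<alpha>r\<^esup>\<close> bounds \<open>w\<close>.
\<close>

section \<open>Smooth functions\<close>

lemma partial_eq: "(f has_derivative f') (at x) \<Longrightarrow> partial b f x = f' b"
  by (simp add: partial_def frechet_derivative_at[symmetric])

text \<open>Lets explicit derivative formulas stand in for the choice-defined
  \<open>frechet_derivative\<close> in inductions on the order.\<close>

lemma C_k_SucI:
  assumes "\<And>x. (f has_derivative f' x) (at x)" and "\<And>b. b \<in> Basis \<Longrightarrow> C_k k (\<lambda>x. f' x b)"
  shows "C_k (Suc k) f"
proof -
  have "partial b f = (\<lambda>x. f' x b)" for b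
    using assms(1) partial_eq by blast
  then show ?thesis
    using assms by (auto simp: differentiable_def)
qed

text \<open>Only differentiability is demanded at each positive order; at order 0 it implies
  continuity, and the recursion carries this over to the partial derivatives.\<close>

lemma C_k_Suc_D: "C_k (Suc k) f \<Longrightarrow> C_k k f"
proof (induction k arbitrary: f)
  case 0
  then show ?case
    by (auto simp: continuous_on_eq_continuous_at differentiable_imp_continuous_within)
qed auto

lemma C_k_Suc_has_derivative:
  "C_k (Suc k) f \<Longrightarrow> (f has_derivative frechet_derivative f (at x)) (at x)"
  by (simp add: frechet_derivative_works)

lemma C_k_const: "C_k k (\<lambda>_. c)"
proof (induction k arbitrary: c)
  case (Suc k)
  show ?case
    by (rule C_k_SucI[where f' = "\<lambda>_ _. 0"]) (auto intro: Suc)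
qed auto

lemma C_k_add: "C_k k f \<Longrightarrow> C_k k g \<Longrightarrow> C_k k (\<lambda>x. f x + g x)"
proof (induction k arbitrary: f g)
  case (Suc k)
  note D = Suc.prems[THEN C_k_Suc_has_derivative]
  show ?case
    by (rule C_k_SucI[OF has_derivative_add[OF D]])
      (use Suc in \<open>auto simp flip: partial_def intro!: Suc.IH\<close>)
qed (auto intro: continuous_intros)

lemma C_k_mult: "C_k k f \<Longrightarrow> C_k k g \<Longrightarrow> C_k k (\<lambda>x. f x * g x)"
proof (induction k arbitrary: f g)
  case (Suc k)
  note D = Suc.prems[THEN C_k_Suc_has_derivative]
  show ?case
  proof (rule C_k_SucI[OF has_derivative_mult[OF D]])
    fix b :: 'a
    assume b: "b \<in> Basis"
    \<comment> \<open>The product rule keeps one factor undifferentiated, so the factors themselves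
      are needed at the lower order too.\<close>
    then have "C_k k (partial b f)" "C_k k (partial b g)" "C_k k f" "C_k k g"
      using Suc.prems C_k_Suc_D by auto
    then show "C_k k (\<lambda>x. f x * frechet_derivative g (at x) b + frechet_derivative f (at x) b * g x)"
      unfolding partial_def[symmetric] by (intro C_k_add Suc.IH)
  qed
qed (auto intro: continuous_intros)

lemma C_k_cmult: "C_k k f \<Longrightarrow> C_k k (\<lambda>x. c * f x)"
  by (intro C_k_mult C_k_const)

lemma C_k_diff: "C_k k f \<Longrightarrow> C_k k g \<Longrightarrow> C_k k (\<lambda>x. f x - g x)"
  using C_k_add[of k f "\<lambda>x. (-1) * g x"] C_k_cmult[of k g "-1"] by simp

lemma C_k_inner: "C_k k (\<lambda>x. x \<bullet> b)"
proof (cases k)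
  case (Suc n)
  show ?thesis
    unfolding Suc by (rule C_k_SucI[where f' = "\<lambda>_ y. y \<bullet> b"])
      (auto intro!: derivative_eq_intros C_k_const)
qed (auto intro!: continuous_intros)

lemma C_k_Suc_realI:
  fixes f :: "real \<Rightarrow> real"
  assumes "\<And>x. (f has_real_derivative f' x) (at x)" and "C_k k f'"
  shows "C_k (Suc k) f"
  using assms by (intro C_k_SucI[where f' = "\<lambda>x h. f' x * h"]) (auto simp: has_field_derivative_def)

lemma C_k_Suc_realD:
  fixes f :: "real \<Rightarrow> real"
  assumes "C_k (Suc k) f"
  shows "(f has_real_derivative deriv f x) (at x)" and "C_k k (deriv f)"
proof -
  show D: "(f has_real_derivative deriv f x) (at x)" for x
    using assms DERIV_deriv_iff_real_differentiable by auto
  have "partial 1 f = deriv f"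
    using partial_eq[OF D[unfolded has_field_derivative_def]] by auto
  then show "C_k k (deriv f)"
    using assms by auto
qed

definition smooth_real :: "(real \<Rightarrow> real) \<Rightarrow> bool" where
  "smooth_real f \<longleftrightarrow> (\<forall>k. C_k k f)"

lemma smooth_real_DERIV:
  "smooth_real f \<Longrightarrow> (f has_real_derivative deriv f x) (at x)"
  unfolding smooth_real_def using C_k_Suc_realD(1) by blast

lemma smooth_real_deriv: "smooth_real f \<Longrightarrow> smooth_real (deriv f)"
  unfolding smooth_real_def using C_k_Suc_realD(2) by blast

lemma smooth_real_continuous: "smooth_real f \<Longrightarrow> continuous_on A f"
  unfolding smooth_real_def using C_k.simps(1) continuous_on_subset by blast

lemma smooth_real_mult: "smooth_real f \<Longrightarrow> smooth_real g \<Longrightarrow> smooth_real (\<lambda>x. f x * g x)"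
  by (simp add: smooth_real_def C_k_mult)

lemma smooth_real_diff: "smooth_real f \<Longrightarrow> smooth_real g \<Longrightarrow> smooth_real (\<lambda>x. f x - g x)"
  by (simp add: smooth_real_def C_k_diff)

lemma smooth_real_measurable: "smooth_real f \<Longrightarrow> f \<in> borel_measurable borel"
  using smooth_real_continuous borel_measurable_continuous_onI by blast

lemma smooth_real_antideriv:
  assumes "\<And>x. (f has_real_derivative f' x) (at x)" and "smooth_real f'"
  shows "smooth_real f"
  unfolding smooth_real_def
proof
  fix k
  show "C_k k f"
    using C_k_Suc_realI[OF assms(1), of k] assms(2) by (auto simp: smooth_real_def intro: C_k_Suc_D)
qed

lemma C_k_affine:
  fixes f :: "real \<Rightarrow> real"
  shows "C_k k f \<Longrightarrow> C_k k (\<lambda>x. f (c * x + d))"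
proof (induction k arbitrary: f)
  case 0
  then show ?case
    by (auto intro!: continuous_intros continuous_on_compose2[of UNIV f])
next
  case (Suc k)
  have "((\<lambda>x. f (c * x + d)) has_real_derivative c * deriv f (c * x + d)) (at x)" for x
  proof (rule DERIV_cong[OF DERIV_chain2[OF C_k_Suc_realD(1)[OF Suc.prems]]])
    show "((\<lambda>x. c * x + d) has_real_derivative c) (at x)"
      by (auto intro!: derivative_eq_intros)
  qed simp
  then show ?case
    by (rule C_k_Suc_realI) (intro C_k_cmult Suc.IH C_k_Suc_realD(2)[OF Suc.prems])
qed

section \<open>The smooth function exp(-1/x) extended by zero\<close>

text \<open>\<open>flat 0\<close> is the classical smooth, non-analytic function. The powers of 1/x
  are included so that derivatives are again linear combinations of members of the family.\<close>

definition flat :: "nat \<Rightarrow> real \<Rightarrow> real" where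
  "flat n x = (if x > 0 then inverse x ^ n * exp (- inverse x) else 0)"

text \<open>With t = 1/x this is the decay of t^n / exp t for t tending to infinity.\<close>

lemma flat_tendsto_0: "((\<lambda>x. inverse x ^ n * exp (- inverse x)) \<longlongrightarrow> (0::real)) (at_right 0)"
proof -
  have "((\<lambda>x. inverse x ^ n / exp (inverse x)) \<longlongrightarrow> (0::real)) (at_right 0)"
    by (rule filterlim_compose[OF tendsto_power_div_exp_0 filterlim_inverse_at_top_right])
  then show ?thesis
    by (simp add: exp_minus divide_inverse)
qed

lemma DERIV_flat: "(flat n has_real_derivative flat (n + 2) x - real n * flat (n + 1) x) (at x)"
proof -
  consider "x > 0" | "x < 0" | "x = 0" by linarith
  then show ?thesis
  proof cases
    case 1
    have "((\<lambda>x. inverse x ^ n * exp (- inverse x)) has_real_derivative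
        flat (n + 2) x - real n * flat (n + 1) x) (at x)"
    proof (rule DERIV_cong[OF DERIV_mult])
      show "((\<lambda>x. inverse x ^ n) has_real_derivative real n * (- (inverse x ^ 2) * inverse x ^ (n - 1))) (at x)"
        using 1 by (auto intro!: derivative_eq_intros simp: power2_eq_square)
      show "((\<lambda>x. exp (- inverse x)) has_real_derivative inverse x ^ 2 * exp (- inverse x)) (at x)"
        using 1 by (auto intro!: derivative_eq_intros simp: power2_eq_square)
      show "real n * (- (inverse x ^ 2) * inverse x ^ (n - 1)) * exp (- inverse x) +
          inverse x ^ 2 * exp (- inverse x) * inverse x ^ n = flat (n + 2) x - real n * flat (n + 1) x"
        using 1 by (cases n) (auto simp: flat_def power2_eq_square algebra_simps)
    qed
    then show ?thesis
      by (rule DERIV_cong_ev[THEN iffD1, rotated -1])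
        (use 1 in \<open>auto simp: flat_def intro!: eventually_mono[OF eventually_nhds_in_open[of "{0<..}"]]\<close>)
  next
    case 2
    have "((\<lambda>x. 0) has_real_derivative flat (n + 2) x - real n * flat (n + 1) x) (at x)"
      using 2 by (auto simp: flat_def)
    then show ?thesis
      by (rule DERIV_cong_ev[THEN iffD1, rotated -1])
        (use 2 in \<open>auto simp: flat_def intro!: eventually_mono[OF eventually_nhds_in_open[of "{..<0}"]]\<close>)
  next
    case 3
    have "((\<lambda>h. (flat n h - flat n 0) / (h - 0)) \<longlongrightarrow> 0) (at 0)"
      unfolding filterlim_at_split
    proof
      show "((\<lambda>h. (flat n h - flat n 0) / (h - 0)) \<longlongrightarrow> 0) (at_left 0)"
        by (rule tendsto_eventually)
          (auto simp: flat_def eventually_at_filter)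
      \<comment> \<open>Dividing by h raises the power of 1/h by one, so the right difference
        quotient is the expression of order n + 1.\<close>
      show "((\<lambda>h. (flat n h - flat n 0) / (h - 0)) \<longlongrightarrow> 0) (at_right 0)"
        by (rule Lim_transform_eventually[OF flat_tendsto_0[of "Suc n"]])
          (auto simp: flat_def eventually_at_filter divide_inverse)
    qed
    then show ?thesis
      using 3 by (simp add: has_field_derivative_iff flat_def)
  qed
qed

text \<open>The exponent stays arbitrary in the induction on the order, because differentiation
  raises it by one and by two.\<close>

lemma smooth_flat: "smooth_real (flat n)"
proof -
  have "C_k k (flat n)" for k n
  proof (induction k arbitrary: n)
    case 0
    show ?case
      using DERIV_isCont[OF DERIV_flat] by (simp add: continuous_on_eq_continuous_at)
  next
    case (Suc k)
    show ?case
      by (rule C_k_Suc_realI[OF DERIV_flat]) (intro C_k_diff C_k_cmult Suc)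
  qed
  then show ?thesis
    by (simp add: smooth_real_def)
qed

section \<open>Test functions on the open half-line\<close>

text \<open>The support keeps a positive distance from 0. This makes division by powers of the
  variable harmless and keeps the associated radial functions smooth at the origin.\<close>

definition test_half :: "(real \<Rightarrow> real) \<Rightarrow> bool" where
  "test_half f \<longleftrightarrow> smooth_real f \<and> (\<exists>a b. 0 < a \<and> a < b \<and> (\<forall>x. x \<notin> {a..b} \<longrightarrow> f x = 0))"

lemma test_halfE:
  assumes "test_half f"
  obtains a b where "0 < a" "a < b" "\<And>x. x < a \<Longrightarrow> f x = 0" "\<And>x. x > b \<Longrightarrow> f x = 0" "smooth_real f"
proof -
  obtain a b where "smooth_real f" "0 < a" "a < b" and 0: "\<forall>x. x \<notin> {a..b} \<longrightarrow> f x = 0"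
    using assms unfolding test_half_def by blast
  moreover have "f x = 0" if "x < a" for x
    using 0 that by simp
  moreover have "f x = 0" if "x > b" for x
    using 0 that by simp
  ultimately show ?thesis
    using that by blast
qed

lemma test_halfI:
  assumes "smooth_real f" "0 < a" "a < b" "\<And>x. x < a \<Longrightarrow> f x = 0" "\<And>x. x > b \<Longrightarrow> f x = 0"
  shows "test_half f"
proof -
  have "\<forall>x. x \<notin> {a..b} \<longrightarrow> f x = 0"
    using assms(4,5) by (auto simp: not_le)
  then show ?thesis
    using assms(1-3) unfolding test_half_def by blast
qed

lemma deriv_eq_0:
  fixes f :: "real \<Rightarrow> real"
  assumes "open A" "x \<in> A" "\<And>y. y \<in> A \<Longrightarrow> f y = c"
  shows "deriv f x = 0"
proof (rule DERIV_imp_deriv)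
  have "((\<lambda>_. c) has_real_derivative 0) (at x)"
    by simp
  then show "(f has_real_derivative 0) (at x)"
    by (rule DERIV_cong_ev[THEN iffD1, rotated -1])
      (use assms in \<open>auto intro!: eventually_mono[OF eventually_nhds_in_open[of A]]\<close>)
qed

lemma test_half_deriv:
  assumes "test_half f"
  shows "test_half (deriv f)"
proof -
  obtain a b where ab: "0 < a" "a < b" "\<And>x. x < a \<Longrightarrow> f x = 0" "\<And>x. x > b \<Longrightarrow> f x = 0"
    "smooth_real f"
    using test_halfE[OF assms] by metis
  have "deriv f x = 0" if "x < a \<or> x > b" for x
    using deriv_eq_0[of "{..<a}" x f 0] deriv_eq_0[of "{b<..}" x f 0] that ab by auto
  then show ?thesis
    using ab smooth_real_deriv by (intro test_halfI[of _ a b]) auto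
qed

lemma test_half_mult:
  assumes "test_half f" "smooth_real g"
  shows "test_half (\<lambda>x. f x * g x)"
proof -
  obtain a b where ab: "0 < a" "a < b" "\<And>x. x < a \<Longrightarrow> f x = 0" "\<And>x. x > b \<Longrightarrow> f x = 0"
    "smooth_real f"
    using test_halfE[OF assms(1)] by metis
  then show ?thesis
    using assms(2) by (intro test_halfI[of _ a b] smooth_real_mult) auto
qed

lemma smooth_id: "smooth_real (\<lambda>x. x)"
  using C_k_inner[where b = "1::real"] by (simp add: smooth_real_def)

lemma test_half_diff:
  assumes "test_half f" "test_half g"
  shows "test_half (\<lambda>x. f x - g x)"
proof -
  obtain a b where ab: "0 < a" "a < b" "\<And>x. x < a \<Longrightarrow> f x = 0" "\<And>x. x > b \<Longrightarrow> f x = 0"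
    "smooth_real f"
    using test_halfE[OF assms(1)] by metis
  moreover obtain c d where "0 < c" "c < d" "\<And>x. x < c \<Longrightarrow> g x = 0" "\<And>x. x > d \<Longrightarrow> g x = 0"
    "smooth_real g"
    using test_halfE[OF assms(2)] by metis
  ultimately show ?thesis
    by (intro test_halfI[of _ "min a c" "max b d"] smooth_real_diff) auto
qed

lemma test_half_cmult:
  assumes "test_half f"
  shows "test_half (\<lambda>x. c * f x)"
  using test_half_mult[OF assms, of "\<lambda>_. c"]
  by (simp add: smooth_real_def C_k_const mult.commute)

text \<open>To the left of the support the quotient is identically zero, also at the origin; to the
  right of 0 the quotient rule applies. The derivative is a combination of quotients of the same
  kind, so the induction on the order leaves \<open>f\<close> and \<open>n\<close>
  arbitrary.\<close>

lemma test_half_divide: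
  assumes "test_half f"
  shows "test_half (\<lambda>x. f x / x ^ n)"
proof -
  have "C_k k (\<lambda>x. f x / x ^ n)" if "test_half f" for k f n
    using that
  proof (induction k arbitrary: f n)
    case (0 f n)
    obtain a b where ab: "0 < a" "a < b" "\<And>x. x < a \<Longrightarrow> f x = 0" "\<And>x. x > b \<Longrightarrow> f x = 0"
      "smooth_real f"
      using test_halfE[OF 0] by metis
    have *: "continuous_on {0<..} (\<lambda>x. f x / x ^ n)"
      by (intro continuous_on_divide continuous_intros smooth_real_continuous[OF ab(5)]) auto
    have "continuous_on {..<a} (\<lambda>x. f x / x ^ n) = continuous_on {..<a} (\<lambda>x. 0::real)"
      by (rule continuous_on_cong) (simp_all add: ab(3))
    \<comment> \<open>Two overlapping open half-lines cover the real line, and continuity is known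
      on each.\<close>
    with * have "continuous_on ({0<..} \<union> {..<a}) (\<lambda>x. f x / x ^ n)"
      by (intro continuous_on_open_Un) auto
    moreover have "{0<..} \<union> {..<a} = UNIV"
      using ab by auto
    ultimately show ?case by simp
  next
    case (Suc k f n)
    obtain a b where ab: "0 < a" "a < b" "\<And>x. x < a \<Longrightarrow> f x = 0" "\<And>x. x > b \<Longrightarrow> f x = 0"
      "smooth_real f"
      using test_halfE[OF Suc.prems] by metis
    show ?case
    proof (rule C_k_Suc_realI)
      fix x
      show "((\<lambda>x. f x / x ^ n) has_real_derivative
          deriv f x / x ^ n - real n * (f x / x ^ Suc n)) (at x)"
      proof (cases "x > 0")
        case True
        have "((\<lambda>x. f x / x ^ n) has_real_derivative
            (deriv f x * x ^ n - f x * (real n * x ^ (n - 1))) / (x ^ n * x ^ n)) (at x)"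
          using True by (intro DERIV_divide smooth_real_DERIV[OF ab(5)] DERIV_pow[of n, simplified]) auto
        moreover have "(deriv f x * x ^ n - f x * (real n * x ^ (n - 1))) / (x ^ n * x ^ n)
            = deriv f x / x ^ n - real n * (f x / x ^ Suc n)"
          using True by (cases n) (auto simp: field_simps)
        ultimately show ?thesis
          by simp
      next
        case False
        have "deriv f x = 0"
          using deriv_eq_0[of "{..<a}" x f 0] ab False by auto
        with False ab have "((\<lambda>x. 0) has_real_derivative
          deriv f x / x ^ n - real n * (f x / x ^ Suc n)) (at x)"
          by auto
        then show ?thesis
          by (rule DERIV_cong_ev[THEN iffD1, rotated -1])
            (use False ab in \<open>auto intro!: eventually_mono[OF eventually_nhds_in_open[of "{..<a}"]]\<close>)
      qed
      show "C_k k (\<lambda>x. deriv f x / x ^ n - real n * (f x / x ^ Suc n))"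
        using Suc test_half_deriv by (intro C_k_diff C_k_cmult Suc.IH) auto
    qed
  qed
  with assms have "smooth_real (\<lambda>x. f x / x ^ n)"
    by (simp add: smooth_real_def)
  moreover obtain a b where "0 < a" "a < b" "\<And>x. x < a \<Longrightarrow> f x = 0" "\<And>x. x > b \<Longrightarrow> f x = 0"
    using test_halfE[OF assms] by metis
  ultimately show ?thesis
    by (intro test_halfI[of _ a b]) auto
qed

text \<open>Each factor is exp(-1/t) at a dilated distance to an endpoint. As \<open>n\<close> grows
  the factors tend to 1 where they are positive, so the bumps approximate the indicator of the open
  interval while staying between 0 and 1.\<close>

definition bump :: "real \<Rightarrow> real \<Rightarrow> nat \<Rightarrow> real \<Rightarrow> real" where
  "bump a b n x = flat 0 (real (Suc n) * (x - a)) * flat 0 (real (Suc n) * (b - x))"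

lemma test_half_bump:
  assumes "0 < a" "a < b"
  shows "test_half (bump a b n)"
proof -
  have "C_k k (\<lambda>x. flat 0 (real (Suc n) * x + (- (real (Suc n) * a))) *
      flat 0 (- real (Suc n) * x + (real (Suc n) * b)))" for k
    using smooth_flat by (intro C_k_mult C_k_affine) (auto simp: smooth_real_def)
  moreover have "(\<lambda>x. flat 0 (real (Suc n) * x + (- (real (Suc n) * a))) *
      flat 0 (- real (Suc n) * x + (real (Suc n) * b))) = bump a b n"
    by (auto simp: bump_def algebra_simps)
  ultimately have "smooth_real (bump a b n)"
    by (auto simp: smooth_real_def)
  moreover have "bump a b n x = 0" if "x \<notin> {a..b}" for x
    using that by (auto simp: bump_def flat_def zero_less_mult_iff)
  ultimately show ?thesis
    using assms by (auto simp: test_half_def)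
qed

lemma bump_nonneg: "bump a b n x \<ge> 0"
  by (auto simp: bump_def flat_def)

lemma bump_le_1: "bump a b n x \<le> 1"
  by (auto simp: bump_def flat_def zero_less_mult_iff mult_le_one)

lemma bump_eq_0: "x \<notin> {a<..<b} \<Longrightarrow> bump a b n x = 0"
  by (auto simp: bump_def flat_def zero_less_mult_iff)

lemma bump_pos: "x \<in> {a<..<b} \<Longrightarrow> bump a b n x > 0"
  by (auto simp: bump_def flat_def)

lemma bump_tendsto: "(\<lambda>n. bump a b n x) \<longlonglongrightarrow> indicator {a<..<b} x"
proof (cases "x \<in> {a<..<b}")
  case True
  have *: "(\<lambda>n. flat 0 (real (Suc n) * y)) \<longlonglongrightarrow> 1" if "y > 0" for y
  proof -
    have "(\<lambda>n. exp (- (inverse (real (Suc n)) * inverse y))) \<longlonglongrightarrow> exp (- (0 * inverse y))"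
      by (intro tendsto_intros LIMSEQ_inverse_real_of_nat)
    then show ?thesis
      using that by (simp add: flat_def zero_less_mult_iff mult.commute)
  qed
  have "(\<lambda>n. bump a b n x) \<longlonglongrightarrow> 1 * 1"
    unfolding bump_def using True by (intro tendsto_mult *) auto
  with True show ?thesis by simp
qed (simp add: bump_eq_0)

section \<open>Weak derivatives on the half-line\<close>

text \<open>\<open>f\<close> is bounded on a compact interval away from 0 that carries its support,
  and \<open>W\<close> is integrable there.\<close>

lemma test_half_integrable:
  assumes W: "\<And>a b. 0 < a \<Longrightarrow> set_integrable lborel {a..b} W" and "test_half f"
  shows "integrable lborel (\<lambda>x. W x * f x)"
proof -
  obtain a b where ab: "0 < a" "a < b" "\<And>x. x < a \<Longrightarrow> f x = 0" "\<And>x. x > b \<Longrightarrow> f x = 0"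
    "smooth_real f"
    using test_halfE[OF assms(2)] by metis
  have "bounded (f ` {a..b})"
    by (intro compact_imp_bounded compact_continuous_image smooth_real_continuous[OF ab(5)]) auto
  then obtain B where B: "\<And>x. x \<in> {a..b} \<Longrightarrow> norm (f x) \<le> B"
    unfolding bounded_iff by blast
  \<comment> \<open>Measurability of \<open>W\<close> is known only on compact intervals away from
    0, so \<open>W\<close> is replaced by its restriction.\<close>
  have eq: "W x * f x = (indicator {a..b} x *\<^sub>R W x) * f x" for x
    using ab(3,4) by (cases "x \<in> {a..b}") (auto simp: not_le)
  have [measurable]: "(\<lambda>x. indicator {a..b} x *\<^sub>R W x) \<in> borel_measurable borel"
    using W[OF ab(1), of b] by (auto simp: set_integrable_def)
  have [measurable]: "f \<in> borel_measurable borel"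
    by (rule smooth_real_measurable[OF ab(5)])
  show ?thesis
    unfolding eq
  proof (rule Bochner_Integration.integrable_bound)
    show "integrable lborel (\<lambda>x. B * norm (indicator {a..b} x *\<^sub>R W x))"
      using W[OF ab(1), of b] by (auto simp: set_integrable_def)
    show "AE x in lborel. norm (indicator {a..b} x *\<^sub>R W x * f x)
        \<le> norm (B * norm (indicator {a..b} x *\<^sub>R W x))"
    proof (intro AE_I2)
      fix x
      show "norm (indicator {a..b} x *\<^sub>R W x * f x) \<le> norm (B * norm (indicator {a..b} x *\<^sub>R W x))"
      proof (cases "x \<in> {a..b}")
        case True
        then have "norm (f x) \<le> \<bar>B\<bar>"
          using B by fastforce
        then show ?thesis
          using True by (simp add: abs_mult mult.commute[of "\<bar>B\<bar>"] mult_left_mono)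
      qed auto
    qed
  qed measurable
qed

lemma set_integrable_continuous_half:
  fixes g :: "real \<Rightarrow> real"
  assumes "continuous_on {0<..} g" "0 < a"
  shows "set_integrable lborel {a..b} g"
  unfolding set_integrable_def
  by (rule borel_integrable_compact[OF compact_Icc continuous_on_subset[OF assms(1)]]) (use assms in auto)

lemma test_half_integrable_self: "test_half f \<Longrightarrow> integrable lborel f"
  using test_half_integrable[of "\<lambda>_. 1" f] set_integrable_continuous_half[of "\<lambda>_. 1"]
  by (auto intro: continuous_intros)

section \<open>The fundamental lemma of the calculus of variations and the lemma of du
  Bois-Reymond\<close>

text \<open>Dynkin's theorem: the sets with vanishing integral are closed under complements and
  countable disjoint unions, and the half-lines are an intersection-stable generator of the Borel
  sets.\<close>

lemma set_lebesgue_integral_zero_if_intervals: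
  fixes f :: "real \<Rightarrow> real"
  assumes f: "integrable lborel f" and zero: "\<And>c. (LBINT x:{..<c}. f x) = 0"
    and A: "A \<in> sets borel"
  shows "(LBINT x:A. f x) = 0"
proof -
  have int: "set_integrable lborel B f" if "B \<in> sets borel" for B
    using integrable_mult_indicator[OF _ f, of B] that by (simp add: set_integrable_def)
  \<comment> \<open>Complements require the integral over the whole line, obtained as the limit
    along increasing half-lines.\<close>
  have UN: "(LBINT x:UNIV. f x) = 0"
  proof (rule LIMSEQ_unique)
    show "(\<lambda>n. LBINT x:{..<real n}. f x) \<longlonglongrightarrow> 0"
      by (simp add: zero)
    have "(\<Union>n. {..<real n}) = (UNIV :: real set)"
      using reals_Archimedean2 by auto
    moreover have "(\<lambda>n. LBINT x:{..<real n}. f x) \<longlonglongrightarrow> (LBINT x:(\<Union>n. {..<real n}). f x)"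
      by (rule set_integral_cont_up) (auto intro: int simp: incseq_def)
    ultimately show "(\<lambda>n. LBINT x:{..<real n}. f x) \<longlonglongrightarrow> (LBINT x:UNIV. f x)"
      by simp
  qed
  have "A \<in> sigma_sets UNIV (range (\<lambda>c::real. {..<c}))"
    using A unfolding borel_Iio by (simp add: sets_measure_of)
  from _ _ this show ?thesis
  proof (rule sigma_sets_induct_disjoint)
    have "{..<a} \<inter> {..<b} = {..<min a b}" for a b :: real
      by auto
    then show "Int_stable (range (\<lambda>c::real. {..<c}))"
      by (auto simp: Int_stable_def)
    show "range (\<lambda>c::real. {..<c}) \<subseteq> Pow UNIV"
      by auto
  next
    fix B :: "real set"
    assume "B \<in> range (\<lambda>c. {..<c})"
    then show "(LBINT x:B. f x) = 0"
      using zero by auto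
  next
    show "(LBINT x:{}. f x) = 0"
      by (simp add: set_lebesgue_integral_def)
  next
    fix B :: "real set"
    assume "B \<in> sigma_sets UNIV (range (\<lambda>c. {..<c}))" and B: "(LBINT x:B. f x) = 0"
    then have [measurable]: "B \<in> sets borel"
      unfolding borel_Iio by (simp add: sets_measure_of)
    have "(LBINT x:B \<union> (UNIV - B). f x) = (LBINT x:B. f x) + (LBINT x:UNIV - B. f x)"
      by (rule set_integral_Un) (auto intro!: int)
    moreover have "B \<union> (UNIV - B) = UNIV"
      by auto
    ultimately show "(LBINT x:UNIV - B. f x) = 0"
      using UN B by simp
  next
    fix B :: "nat \<Rightarrow> real set"
    assume B: "disjoint_family B" "range B \<subseteq> sigma_sets UNIV (range (\<lambda>c. {..<c}))"
      "\<And>i. (LBINT x:B i. f x) = 0"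
    then have [measurable]: "B i \<in> sets borel" for i
      unfolding borel_Iio by (auto simp add: sets_measure_of)
    have "(LBINT x:(\<Union>i. B i). f x) = (\<Sum>i. LBINT x:B i. f x)"
      by (rule lebesgue_integral_countable_add)
        (use B(1) in \<open>auto intro!: int simp: disjoint_family_on_def\<close>)
    then show "(LBINT x:(\<Union>i. B i). f x) = 0"
      using B(3) by simp
  qed
qed

text \<open>Bumps converge to indicators, so dominated convergence turns the hypothesis into
  vanishing integrals over intervals. Hence \<open>V\<close> vanishes almost everywhere on each of
  countably many intervals that exhaust the half-line.\<close>

lemma AE_zero_if_test_half:
  assumes V: "\<And>a b. 0 < a \<Longrightarrow> set_integrable lborel {a..b} V"
    and zero: "\<And>f. test_half f \<Longrightarrow> (LBINT x. V x * f x) = 0"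
  shows "AE x in lborel. x > 0 \<longrightarrow> V x = 0"
proof -
  have int: "set_integrable lborel {a<..<b} V" if "0 < a" for a b
    by (rule set_integrable_subset[OF V[OF that, of b]]) auto
  have I: "(LBINT x:{a<..<b}. V x) = 0" if ab: "0 < a" "a < b" for a b
  proof (rule LIMSEQ_unique)
    have [measurable]: "(\<lambda>x. indicator {a<..<b} x * V x) \<in> borel_measurable borel"
      using int[OF ab(1), of b] by (auto simp: set_integrable_def)
    have [measurable]: "bump a b n \<in> borel_measurable borel" for n
      using test_half_bump[OF ab] by (auto simp: test_half_def intro: smooth_real_measurable)
    have eq: "V x * bump a b n x = indicator {a<..<b} x * V x * bump a b n x" for x n
      by (cases "x \<in> {a<..<b}") (auto simp: bump_eq_0)
    show "(\<lambda>n. LBINT x. V x * bump a b n x) \<longlonglongrightarrow> (LBINT x:{a<..<b}. V x)"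
      unfolding set_lebesgue_integral_def real_scaleR_def
    proof (rule integral_dominated_convergence)
      show "integrable lborel (\<lambda>x. \<bar>indicator {a<..<b} x * V x\<bar>)"
        using int[OF ab(1), of b] by (auto simp: set_integrable_def)
      show "(\<lambda>x. V x * bump a b n x) \<in> borel_measurable lborel" for n
        unfolding eq by measurable
      show "AE x in lborel. (\<lambda>n. V x * bump a b n x) \<longlonglongrightarrow> indicator {a<..<b} x * V x"
        using tendsto_mult[OF tendsto_const bump_tendsto] by (auto simp: mult.commute)
      show "AE x in lborel. norm (V x * bump a b n x) \<le> \<bar>indicator {a<..<b} x * V x\<bar>" for n
        unfolding eq using bump_le_1[of a b n] bump_nonneg[of a b n]
        by (auto simp: abs_mult intro!: mult_left_le)
    qed measurable
    show "(\<lambda>n. LBINT x. V x * bump a b n x) \<longlonglongrightarrow> 0"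
      using zero[OF test_half_bump[OF ab]] by simp
  qed
  have AB: "AE x in lborel. x \<in> {a<..<b} \<longrightarrow> V x = 0" if "0 < a" for a b
  proof -
    define f where "f x = indicator {a<..<b} x * V x" for x
    have f: "integrable lborel f"
      using int[OF that, of b] by (simp add: set_integrable_def f_def[abs_def])
    have "(LBINT x:{..<c}. f x) = 0" for c
    proof -
      \<comment> \<open>A half-line meets the interval in another interval with the same left end,
        possibly empty.\<close>
      have "(LBINT x:{..<c}. f x) = (LBINT x:{a<..<min c b}. V x)"
        unfolding set_lebesgue_integral_def f_def
        by (rule Bochner_Integration.integral_cong) (auto simp: indicator_def)
      also have "\<dots> = 0"
        using I[OF that, of "min c b"] by (cases "a < min c b") (auto simp: set_lebesgue_integral_def)
      finally show ?thesis .
    qed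
    \<comment> \<open>\<open>f\<close> and 0 have the same integral over every Borel set, so they
      agree almost everywhere as densities.\<close>
    then have "AE x in lborel. f x = 0"
      using density_unique_real[of lborel f "\<lambda>_. 0"] f set_lebesgue_integral_zero_if_intervals[OF f]
      by (simp add: set_lebesgue_integral_def)
    then show ?thesis
      by eventually_elim (auto simp: f_def)
  qed
  have "AE x in lborel. \<forall>n. x \<in> {1 / real (Suc n)<..<real n} \<longrightarrow> V x = 0"
    unfolding AE_all_countable by (intro allI AB) auto
  then show ?thesis
  proof eventually_elim
    case (elim x)
    show ?case
    proof
      assume "x > 0"
      then obtain n where n: "inverse (real (Suc n)) < x"
        using reals_Archimedean by blast
      obtain m where m: "x < real m"
        using reals_Archimedean2 by blast
      have "1 / real (Suc (max n m)) \<le> inverse (real (Suc n))"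
        by (simp add: field_simps)
      with n m have "x \<in> {1 / real (Suc (max n m))<..<real (max n m)}"
        by auto
      with elim show "V x = 0" by blast
    qed
  qed
qed

lemma antiderivative_UNIV:
  fixes f :: "real \<Rightarrow> real"
  assumes "continuous_on UNIV f"
  obtains F where "\<And>x. (F has_real_derivative f x) (at x)"
  using einterval_antiderivative[of "-\<infinity>" \<infinity> f] assms
  by (auto simp: has_real_derivative_iff_has_vector_derivative continuous_on_eq_continuous_at)

lemma antiderivative_half:
  fixes f :: "real \<Rightarrow> real"
  assumes "continuous_on {0<..} f"
  obtains F where "\<And>x. x > 0 \<Longrightarrow> (F has_real_derivative f x) (at x)"
  using einterval_antiderivative[of 0 \<infinity> f] assms
  by (auto simp: has_real_derivative_iff_has_vector_derivative continuous_on_eq_continuous_at)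

text \<open>An antiderivative is constant on both sides of the support. Normalising it to 0 on the
  left makes its value on the right the integral of \<open>f\<close>, which vanishes.\<close>

lemma test_half_antiderivative:
  assumes f: "test_half f" and zero: "(LBINT x. f x) = 0"
  obtains F where "test_half F" "\<And>x. (F has_real_derivative f x) (at x)"
proof -
  obtain a b where ab: "0 < a" "a < b" "\<And>x. x < a \<Longrightarrow> f x = 0" "\<And>x. x > b \<Longrightarrow> f x = 0"
    "smooth_real f"
    using test_halfE[OF f] by metis
  obtain G where G: "\<And>x. (G has_real_derivative f x) (at x)"
    using antiderivative_UNIV[OF smooth_real_continuous[OF ab(5)]] by metis
  \<comment> \<open>The point a / 2 lies to the left of the support.\<close>
  define F where "F x = G x - G (a / 2)" for x
  have F: "(F has_real_derivative f x) (at x)" for x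
    unfolding F_def using G by (auto intro!: derivative_eq_intros)
  have l: "F x = 0" if "x < a" for x
  proof -
    have "\<exists>c. \<forall>x\<in>{..<a}. F x = c"
    proof (rule has_field_derivative_zero_constant)
      show "(F has_real_derivative 0) (at y within {..<a})" if "y \<in> {..<a}" for y
        using F[of y] ab(3)[of y] that by (simp add: has_field_derivative_at_within)
    qed simp
    then have "F x = F (a / 2)"
      using that ab(1) by fastforce
    then show ?thesis
      by (simp add: F_def)
  qed
  have r: "F x = 0" if "x > b" for x
  proof -
    have "(LBINT y. indicator {a / 2..x} y *\<^sub>R f y) = F x - F (a / 2)"
      by (rule integral_FTC_Icc)
        (use ab that F smooth_real_continuous in
          \<open>auto simp: has_real_derivative_iff_has_vector_derivative[symmetric]
            intro: has_field_derivative_at_within\<close>)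
    moreover have "(\<lambda>y. indicator {a / 2..x} y *\<^sub>R f y) = f"
    proof
      fix y
      show "indicator {a / 2..x} y *\<^sub>R f y = f y"
        using ab(1-4) that by (cases "y < a \<or> y > b") auto
    qed
    ultimately show ?thesis
      using zero l[of "a / 2"] ab(1) by simp
  qed
  have "test_half F"
    using smooth_real_antideriv[OF F ab(5)] ab l r by (intro test_halfI[of _ a b]) auto
  with F that show ?thesis by blast
qed

text \<open>If the integral vanished, the interval on which the bump is positive would be a null
  set. Positivity allows normalisation to mass one.\<close>

lemma integral_bump_pos:
  assumes "0 < a" "a < b"
  shows "(LBINT x. bump a b n x) > 0"
proof (rule ccontr)
  assume "\<not> ?thesis"
  then have "(LBINT x. bump a b n x) = 0"
    using Bochner_Integration.integral_nonneg[of lborel "bump a b n", OF bump_nonneg] by linarith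
  then have "AE x in lborel. bump a b n x = 0"
    using integral_nonneg_eq_0_iff_AE[of lborel "bump a b n"] bump_nonneg
      test_half_integrable_self[OF test_half_bump[OF assms]] by auto
  then have "AE x in lborel. x \<notin> {a<..<b}"
  proof eventually_elim
    case (elim x)
    then show ?case
      using bump_pos[of x a b n] by auto
  qed
  then have "{a<..<b} \<in> null_sets lborel"
    by (simp add: AE_iff_null_sets)
  then show False
    using assms by (auto simp: null_sets_def)
qed

text \<open>Subtracting from \<open>f\<close> its integral times a fixed function \<theta> of mass
  one leaves a test function of integral zero, hence the derivative of a test function. So
  \<open>W\<close> minus the constant \<integral> W \<theta> annihilates all test functions.\<close>

lemma AE_constant_if_test_half:
  assumes W: "\<And>a b. 0 < a \<Longrightarrow> set_integrable lborel {a..b} W"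
    and zero: "\<And>f. test_half f \<Longrightarrow> (LBINT x. W x * deriv f x) = 0"
  obtains c where "AE x in lborel. x > 0 \<longrightarrow> W x = c"
proof -
  define \<theta> where "\<theta> x = bump 1 2 0 x / (LBINT x. bump 1 2 0 x)" for x
  have T: "test_half \<theta>"
    using test_half_cmult[OF test_half_bump[of 1 2 0], of "1 / (LBINT x. bump 1 2 0 x)"]
    by (simp add: \<theta>_def[abs_def])
  have [simp]: "(LBINT x. \<theta> x) = 1"
    using integral_bump_pos[of 1 2 0] by (simp add: \<theta>_def)
  define c where "c = (LBINT x. W x * \<theta> x)"
  have "(LBINT x. (W x - c) * f x) = 0" if f: "test_half f" for f
  proof -
    define I where "I = (LBINT x. f x)"
    have R: "test_half (\<lambda>x. f x - I * \<theta> x)"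
      by (intro test_half_diff test_half_cmult f T)
    have "(LBINT x. f x - I * \<theta> x) = 0"
      using test_half_integrable_self[OF f] test_half_integrable_self[OF T] by (simp add: I_def)
    from test_half_antiderivative[OF R this] obtain F where
      F: "test_half F" "\<And>x. (F has_real_derivative f x - I * \<theta> x) (at x)" by blast
    then have "deriv F x = f x - I * \<theta> x" for x
      by (simp add: DERIV_imp_deriv)
    with zero[OF F(1)] have "(LBINT x. W x * f x - I * (W x * \<theta> x)) = 0"
      by (simp add: algebra_simps)
    then have "(LBINT x. W x * f x) = I * c"
      using test_half_integrable[OF W f] test_half_integrable[OF W T] by (simp add: c_def)
    moreover have "(LBINT x. (W x - c) * f x) = (LBINT x. W x * f x) - c * I"
      using test_half_integrable[OF W f] test_half_integrable_self[OF f]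
      by (simp add: left_diff_distrib I_def)
    ultimately show ?thesis by simp
  qed
  then have "AE x in lborel. x > 0 \<longrightarrow> W x - c = 0"
    by (intro AE_zero_if_test_half set_integral_diff W set_integrable_continuous_half) auto
  then show ?thesis
    by (intro that[of c]) auto
qed

text \<open>A classical antiderivative \<open>v\<close> of \<open>g\<close> satisfies the same weak
  equation, so \<open>U\<close> - \<open>v\<close> has weak derivative zero and is constant almost
  everywhere.\<close>

lemma weak_derivative_half:
  assumes U: "\<And>a b. 0 < a \<Longrightarrow> set_integrable lborel {a..b} U"
    and g: "continuous_on {0<..} g"
    and weak: "\<And>f. test_half f \<Longrightarrow> (LBINT x. U x * deriv f x) = - (LBINT x. g x * f x)"
  obtains u where "AE x in lborel. x > 0 \<longrightarrow> U x = u x"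
    "\<And>x. x > 0 \<Longrightarrow> (u has_real_derivative g x) (at x)"
proof -
  obtain v where v: "\<And>x. x > 0 \<Longrightarrow> (v has_real_derivative g x) (at x)"
    using antiderivative_half[OF g] by metis
  have vc: "continuous_on {0<..} v"
    using v by (meson DERIV_isCont continuous_at_imp_continuous_on greaterThan_iff)
  note vI = set_integrable_continuous_half[OF vc]
  note gI = set_integrable_continuous_half[OF g]
  have "(LBINT x. (U x - v x) * deriv f x) = 0" if f: "test_half f" for f
  proof -
    obtain a b where ab: "0 < a" "a < b" "\<And>x. x < a \<Longrightarrow> f x = 0" "\<And>x. x > b \<Longrightarrow> f x = 0"
      "smooth_real f"
      using test_halfE[OF f] by metis
    note i = test_half_integrable[OF vI test_half_deriv[OF f]] test_half_integrable[OF gI f]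
    have d0: "deriv f x = 0" if "x < a \<or> x > b" for x
      using deriv_eq_0[of "{..<a}" x f 0] deriv_eq_0[of "{b<..}" x f 0] that ab by auto
    have "(LBINT x. v x * deriv f x) + (LBINT x. g x * f x) = (LBINT x. v x * deriv f x + g x * f x)"
      using i by simp
    \<comment> \<open>Integration by parts on an interval containing the support in its interior, so
      that both boundary terms vanish.\<close>
    also have "\<dots> = (LBINT x. indicator {a / 2..b + 1} x *\<^sub>R (v x * deriv f x + g x * f x))"
    proof (rule Bochner_Integration.integral_cong)
      fix x
      show "v x * deriv f x + g x * f x =
          indicator {a / 2..b + 1} x *\<^sub>R (v x * deriv f x + g x * f x)"
        using ab(1-4) d0[of x] by (cases "x < a \<or> x > b") auto
    qed simp
    also have "\<dots> = v (b + 1) * f (b + 1) - v (a / 2) * f (a / 2)"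
    proof (rule integral_FTC_Icc)
      fix x assume "a / 2 \<le> x" "x \<le> b + 1"
      then have "x > 0" using ab by auto
      have "((\<lambda>x. v x * f x) has_real_derivative (v x * deriv f x + g x * f x)) (at x)"
        by (rule DERIV_cong[OF DERIV_mult[OF v[OF \<open>x > 0\<close>] smooth_real_DERIV[OF ab(5)]]]) simp
      then show "((\<lambda>x. v x * f x) has_vector_derivative (v x * deriv f x + g x * f x))
          (at x within {a / 2..b + 1})"
        using has_field_derivative_at_within has_real_derivative_iff_has_vector_derivative by blast
    next
      show "continuous_on {a / 2..b + 1} (\<lambda>x. v x * deriv f x + g x * f x)"
        using ab
        by (intro continuous_intros smooth_real_continuous smooth_real_deriv
            continuous_on_subset[OF vc] continuous_on_subset[OF g]) auto
    qed (use ab in auto)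
    also have "\<dots> = 0"
      using ab by simp
    finally have "(LBINT x. v x * deriv f x) = - (LBINT x. g x * f x)"
      by simp
    then show ?thesis
      using weak[OF f] test_half_integrable[OF U test_half_deriv[OF f]] i
      by (simp add: left_diff_distrib)
  qed
  then obtain c where c: "AE x in lborel. x > 0 \<longrightarrow> U x - v x = c"
    using AE_constant_if_test_half[of "\<lambda>x. U x - v x"] U vI by (metis set_integral_diff(1))
  show ?thesis
  proof (rule that[of "\<lambda>x. v x + c"])
    show "AE x in lborel. x > 0 \<longrightarrow> U x = v x + c"
      using c by eventually_elim auto
  qed (auto intro!: derivative_eq_intros v)
qed

section \<open>Radial functions in three dimensions\<close>

text \<open>Writing the derivative of the profile as r k(r) makes the gradient x k(|x|), a formula
  without division that also covers the origin, near which the function is constant.\<close>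

lemma has_derivative_radial:
  fixes x :: "'a::euclidean_space" and g k :: "real \<Rightarrow> real"
  assumes g: "\<And>r. r > 0 \<Longrightarrow> (g has_real_derivative r * k r) (at r)"
    and a: "a > 0" "\<And>r. r < a \<Longrightarrow> g r = c" and k: "k 0 = 0"
  shows "((\<lambda>x. g (norm x)) has_derivative (\<lambda>h. (x \<bullet> h) * k (norm x))) (at x)"
proof (cases "x = 0")
  case True
  have "((\<lambda>x::'a. c) has_derivative (\<lambda>h. (x \<bullet> h) * k (norm x))) (at x)"
    using True k by auto
  then show ?thesis
    by (rule has_derivative_transform_within_open[of _ _ _ _ "ball 0 a"]) (use True a in auto)
next
  case False
  have "((\<lambda>x. g (norm x)) has_derivative (\<lambda>h. (h \<bullet> sgn x) * (norm x * k (norm x)))) (at x)"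
    using has_derivative_compose[OF has_derivative_norm[OF False]
        g[of "norm x", unfolded has_field_derivative_def]] False
    by (simp add: mult.commute inner_commute)
  moreover have "(\<lambda>h. (h \<bullet> sgn x) * (norm x * k (norm x))) = (\<lambda>h. (x \<bullet> h) * k (norm x))"
    using False by (auto simp: sgn_div_norm inner_commute)
  ultimately show ?thesis
    by simp
qed

text \<open>Each partial derivative is a coordinate times a radial function with profile f'/r, which
  is again a test function on the half-line; hence the induction with \<open>f\<close>
  arbitrary.\<close>

lemma C_k_radial: "test_half f \<Longrightarrow> C_k k (\<lambda>x::'a::euclidean_space. f (norm x))"
proof (induction k arbitrary: f)
  case 0
  then show ?case
    by (auto simp: test_half_def intro!: continuous_on_compose2[OF smooth_real_continuous[of f UNIV]]
        continuous_intros)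
next
  case (Suc k)
  obtain a b where ab: "0 < a" "a < b" "\<And>x. x < a \<Longrightarrow> f x = 0" "\<And>x. x > b \<Longrightarrow> f x = 0"
    "smooth_real f"
    using test_halfE[OF Suc.prems] by metis
  have D: "((\<lambda>x. f (norm x)) has_derivative (\<lambda>h. (x \<bullet> h) * (deriv f (norm x) / norm x))) (at x)"
    for x :: 'a
    by (rule has_derivative_radial[of f "\<lambda>r. deriv f r / r" a 0])
      (use ab smooth_real_DERIV[OF ab(5)] in auto)
  show ?case
  proof (rule C_k_SucI[OF D])
    fix b :: 'a
    have "test_half (\<lambda>r. deriv f r / r)"
      using test_half_divide[OF test_half_deriv[OF Suc.prems], of 1] by simp
    from Suc.IH[OF this] show "C_k k (\<lambda>x. (x \<bullet> b) * (deriv f (norm x) / norm x))"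
      by (intro C_k_mult C_k_inner)
  qed
qed

text \<open>The gradient is x \<kappa>(|x|) and the Laplacian is its divergence. The profile \<psi>
  is constant near the origin, where \<kappa> vanishes, but that constant may be nonzero.\<close>

lemma
  fixes \<psi> \<kappa> :: "real \<Rightarrow> real"
  assumes \<kappa>: "test_half \<kappa>" and \<psi>: "\<And>r. (\<psi> has_real_derivative r * \<kappa> r) (at r)"
    and b: "\<And>r. r > b \<Longrightarrow> \<psi> r = 0"
  shows test_fun_radial: "test_fun (\<lambda>x::'a::euclidean_space. \<psi> (norm x))"
    and laplacian_radial: "laplacian (\<lambda>x::'a. \<psi> (norm x)) x
      = DIM('a) * \<kappa> (norm x) + norm x * deriv \<kappa> (norm x)"
proof -
  obtain a d where ab: "0 < a" "a < d" "\<And>x. x < a \<Longrightarrow> \<kappa> x = 0" "\<And>x. x > d \<Longrightarrow> \<kappa> x = 0"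
    "smooth_real \<kappa>"
    using test_halfE[OF \<kappa>] by metis
  have "\<exists>c. \<forall>r\<in>{..<a}. \<psi> r = c"
  proof (rule has_field_derivative_zero_constant)
    show "(\<psi> has_real_derivative 0) (at y within {..<a})" if "y \<in> {..<a}" for y
      using \<psi>[of y] ab(3)[of y] that by (simp add: has_field_derivative_at_within)
  qed simp
  then obtain c where c: "\<And>r. r < a \<Longrightarrow> \<psi> r = c"
    by auto
  have D: "((\<lambda>x. \<psi> (norm x)) has_derivative (\<lambda>h. (x \<bullet> h) * \<kappa> (norm x))) (at x)" for x :: 'a
    using has_derivative_radial[of \<psi> \<kappa> a c x] \<psi> ab(1,3) c by auto
  have "C_k k (\<lambda>x::'a. \<psi> (norm x))" for k
  proof (rule C_k_Suc_D, rule C_k_SucI[OF D])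
    fix b :: 'a
    show "C_k k (\<lambda>x. (x \<bullet> b) * \<kappa> (norm x))"
      by (intro C_k_mult C_k_inner C_k_radial \<kappa>)
  qed
  moreover have "closure {x::'a. \<psi> (norm x) \<noteq> 0} \<subseteq> cball 0 b"
    by (rule closure_minimal) (use b in \<open>auto simp flip: not_less\<close>)
  then have "compact (closure {x::'a. \<psi> (norm x) \<noteq> 0})"
    by (meson bounded_cball bounded_subset closed_closure compact_eq_bounded_closed)
  ultimately show "test_fun (\<lambda>x::'a. \<psi> (norm x))"
    by (simp add: test_fun_def)
  have D2: "((\<lambda>x. \<kappa> (norm x)) has_derivative (\<lambda>h. (x \<bullet> h) * (deriv \<kappa> (norm x) / norm x))) (at x)"
    for x :: 'a
    by (rule has_derivative_radial[of \<kappa> "\<lambda>r. deriv \<kappa> r / r" a 0])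
      (use ab smooth_real_DERIV[OF ab(5)] in auto)
  have p: "partial b (\<lambda>x. \<psi> (norm x)) = (\<lambda>x. (x \<bullet> b) * \<kappa> (norm x))" for b :: 'a
    using partial_eq[OF D] by auto
  have D3: "((\<lambda>x. (x \<bullet> b) * \<kappa> (norm x)) has_derivative
      (\<lambda>h. (x \<bullet> b) * ((x \<bullet> h) * (deriv \<kappa> (norm x) / norm x)) + (h \<bullet> b) * \<kappa> (norm x))) (at x)"
    for b :: 'a
    by (intro has_derivative_mult D2 has_derivative_inner_left has_derivative_ident)
  have "laplacian (\<lambda>x. \<psi> (norm x)) x =
      (\<Sum>b\<in>Basis. (x \<bullet> b) * (x \<bullet> b) * (deriv \<kappa> (norm x) / norm x) + \<kappa> (norm x))"
    unfolding laplacian_def p using partial_eq[OF D3]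
    by (intro sum.cong) (auto simp: algebra_simps)
  also have "\<dots> = (norm x)\<^sup>2 * (deriv \<kappa> (norm x) / norm x) + DIM('a) * \<kappa> (norm x)"
    by (simp only: sum.distrib sum_distrib_right[symmetric] euclidean_inner[of x x, symmetric]
        power2_norm_eq_inner sum_constant)
  finally show "laplacian (\<lambda>x. \<psi> (norm x)) x
      = DIM('a) * \<kappa> (norm x) + norm x * deriv \<kappa> (norm x)"
    by (cases "x = 0") (auto simp: power2_eq_square)
qed

section \<open>Integration of radial functions in polar coordinates\<close>

text \<open>Expressed through the volume of the unit ball, so that \<open>sphere_area\<close> r^2 is
  the derivative of the volume of the ball of radius r.\<close>

definition sphere_area :: real where
  "sphere_area = 3 * unit_ball_vol 3"

lemma sphere_area_pos: "sphere_area > 0"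
  by (simp add: sphere_area_def)

text \<open>Both measures are compared on the half-lines {..a}: their preimages under the norm are
  balls, whose volume is the integral of the density. For a < 0 both sides are zero.\<close>

lemma distr_norm:
  "distr lborel borel (norm :: real^3 \<Rightarrow> real) =
    density lborel (\<lambda>r. ennreal (sphere_area * r\<^sup>2 * indicator {0..} r))"
proof (rule measure_eqI_generator_eq[where E = "range (\<lambda>a::real. {..a})" and \<Omega> = UNIV
      and A = "\<lambda>n. {..real n}"])
  have "{..a} \<inter> {..b} = {..min a b}" for a b :: real
    by auto
  then show "Int_stable (range (\<lambda>c::real. {..c}))"
    by (auto simp: Int_stable_def)
next
  fix X :: "real set"
  assume "X \<in> range (\<lambda>a. {..a})"
  then obtain a where X: "X = {..a}" by auto
  have vim: "norm -` {..a} = cball (0::real^3) a"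
    by auto
  have L: "emeasure (distr lborel borel (norm :: real^3 \<Rightarrow> real)) X = emeasure lborel (cball (0::real^3) a)"
    unfolding X by (subst emeasure_distr) (auto simp: vim)
  have R: "emeasure (density lborel (\<lambda>r. ennreal (sphere_area * r\<^sup>2 * indicator {0..} r))) X
      = (\<integral>\<^sup>+r. ennreal (sphere_area * r\<^sup>2) * indicator {0..a} r \<partial>lborel)"
    unfolding X by (subst emeasure_density) (auto intro!: nn_integral_cong simp: indicator_def)
  show "emeasure (distr lborel borel (norm :: real^3 \<Rightarrow> real)) X =
      emeasure (density lborel (\<lambda>r. ennreal (sphere_area * r\<^sup>2 * indicator {0..} r))) X"
  proof (cases "a \<ge> 0")
    case True
    have "(\<integral>\<^sup>+r. ennreal (sphere_area * r\<^sup>2) * indicator {0..a} r \<partial>lborel)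
        = ennreal (unit_ball_vol 3 * a ^ 3 - unit_ball_vol 3 * 0 ^ 3)"
      by (rule nn_integral_FTC_Icc)
        (use True sphere_area_pos in \<open>auto intro!: derivative_eq_intros simp: sphere_area_def\<close>)
    then show ?thesis
      unfolding L R using emeasure_cball[OF True, of "0::real^3"] by simp
  next
    case False
    then show ?thesis
      unfolding L R by simp
  qed
next
  \<comment> \<open>Finite measure on an exhausting sequence of half-lines is what extends the
    equality from the generator to all Borel sets.\<close>
  show "emeasure (distr lborel borel (norm :: real^3 \<Rightarrow> real)) {..real n} \<noteq> \<infinity>" for n
  proof -
    have "norm -` {..real n} = cball (0::real^3) (real n)"
      by auto
    then show ?thesis
      using emeasure_cball[of "real n" "0::real^3"] by (subst emeasure_distr) auto
  qed
  show "(\<Union>n. {..real n}) = UNIV"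
    using real_arch_simple by auto
qed (auto simp: borel_eq_atMost sets_measure_of)

text \<open>Restriction to a coordinate axis recovers the profile, but only as a function of |r|:
  its values at negative arguments are invisible to \<open>rad3\<close>.\<close>

lemma borel_measurable_rad3:
  assumes "rad3 f \<in> borel_measurable borel"
  shows "(\<lambda>r. f \<bar>r\<bar>) \<in> borel_measurable borel"
proof -
  have "(\<lambda>r. rad3 f (r *\<^sub>R axis 1 1)) \<in> borel_measurable borel"
    by (rule measurable_compose[OF _ assms]) auto
  then show ?thesis
    by (simp add: rad3_def)
qed

text \<open>Change of variables along the norm, applied to f(|r|), which is measurable on the whole
  line.\<close>

lemma
  assumes f: "rad3 f \<in> borel_measurable borel"
  shows integrable_rad3: "integrable lborel (rad3 f) \<longleftrightarrow> set_integrable lborel {0..} (\<lambda>r. r\<^sup>2 * f r)"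
    and integral_rad3: "(LBINT x. rad3 f x) = sphere_area * (LBINT r:{0..}. r\<^sup>2 * f r)"
proof -
  note [measurable] = borel_measurable_rad3[OF f]
  have rad: "rad3 f = (\<lambda>x. f \<bar>norm x\<bar>)"
    by (auto simp: rad3_def)
  have eq: "(sphere_area * r\<^sup>2 * indicator {0..} r) *\<^sub>R f \<bar>r\<bar>
      = sphere_area * (indicator {0..} r *\<^sub>R (r\<^sup>2 * f r))" for r
    by (auto simp: indicator_def)
  have "integrable lborel (rad3 f) \<longleftrightarrow> integrable (distr lborel borel (norm :: real^3 \<Rightarrow> real)) (\<lambda>r. f \<bar>r\<bar>)"
    unfolding rad by (subst integrable_distr_eq) auto
  also have "\<dots> \<longleftrightarrow> integrable lborel (\<lambda>r. sphere_area * (indicator {0..} r *\<^sub>R (r\<^sup>2 * f r)))"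
    unfolding distr_norm eq[symmetric]
    by (rule integrable_density) (use sphere_area_pos in auto)
  also have "\<dots> \<longleftrightarrow> set_integrable lborel {0..} (\<lambda>r. r\<^sup>2 * f r)"
    unfolding set_integrable_def using sphere_area_pos by (subst integrable_mult_left_iff) auto
  finally show "integrable lborel (rad3 f) \<longleftrightarrow> set_integrable lborel {0..} (\<lambda>r. r\<^sup>2 * f r)" .
  have "(LBINT x. rad3 f x) = integral\<^sup>L (distr lborel borel (norm :: real^3 \<Rightarrow> real)) (\<lambda>r. f \<bar>r\<bar>)"
    unfolding rad by (subst integral_distr) auto
  also have "\<dots> = (LBINT r. sphere_area * (indicator {0..} r *\<^sub>R (r\<^sup>2 * f r)))"
    unfolding distr_norm eq[symmetric]
    by (rule integral_density) (use sphere_area_pos in auto)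
  finally show "(LBINT x. rad3 f x) = sphere_area * (LBINT r:{0..}. r\<^sup>2 * f r)"
    by (simp add: set_lebesgue_integral_def)
qed

text \<open>Cutting the profile off at \<open>R\<close> amounts to restricting the radial function
  to a closed ball, which makes it globally integrable.\<close>

lemma loc_integrable_rad3:
  assumes "loc_integrable (rad3 f)"
  shows "set_integrable lborel {0..R} (\<lambda>r. r\<^sup>2 * f r)"
proof -
  define g where "g r = indicator {..R} r * f r" for r
  have "set_integrable lborel (cball (0::real^3) R) (rad3 f)"
    using assms by (auto simp: loc_integrable_def)
  then have int: "integrable lborel (rad3 g)"
    unfolding set_integrable_def
    by (rule Bochner_Integration.integrable_cong[THEN iffD1, rotated -1])
      (auto simp: rad3_def g_def indicator_def)
  have "set_integrable lborel {0..} (\<lambda>r. r\<^sup>2 * g r)"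
    using int integrable_rad3[of g] by (simp add: borel_measurable_integrable)
  then show ?thesis
    unfolding set_integrable_def
    by (rule Bochner_Integration.integrable_cong[THEN iffD1, rotated -1])
      (auto simp: g_def indicator_def)
qed

text \<open>On r \<ge> a the weight r^2 is at least a^2 and can be divided out.\<close>

lemma loc_integrable_rad3_away_0:
  assumes "loc_integrable (rad3 f)" "0 < a"
  shows "set_integrable lborel {a..b} f"
proof -
  have i: "set_integrable lborel {a..b} (\<lambda>r. r\<^sup>2 * f r)"
    by (rule set_integrable_subset[OF loc_integrable_rad3[OF assms(1), of b]]) (use assms in auto)
  then have [measurable]: "(\<lambda>r. indicator {a..b} r *\<^sub>R (r\<^sup>2 * f r)) \<in> borel_measurable borel"
    by (auto simp: set_integrable_def)
  have eq: "indicator {a..b} r *\<^sub>R f r = (indicator {a..b} r *\<^sub>R (r\<^sup>2 * f r)) * (1 / r\<^sup>2)" for r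
    using assms(2) by (auto simp: indicator_def)
  show ?thesis
    unfolding set_integrable_def
  proof (rule Bochner_Integration.integrable_bound)
    show "integrable lborel (\<lambda>r. (indicator {a..b} r *\<^sub>R (r\<^sup>2 * f r)) * (1 / a\<^sup>2))"
      using i by (simp add: set_integrable_def)
    show "(\<lambda>r. indicator {a..b} r *\<^sub>R f r) \<in> borel_measurable lborel"
      unfolding eq by measurable
    have "1 / r\<^sup>2 \<le> 1 / a\<^sup>2" if "r \<ge> a" for r
      using assms(2) that by (intro divide_left_mono power_mono) auto
    then have "norm (indicator {a..b} r *\<^sub>R f r)
        \<le> norm ((indicator {a..b} r *\<^sub>R (r\<^sup>2 * f r)) * (1 / a\<^sup>2))" for r
      unfolding eq norm_mult
      by (cases "r \<ge> a") (auto intro!: mult_left_mono simp del: times_divide_eq_right)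
    then show "AE r in lborel. norm (indicator {a..b} r *\<^sub>R f r)
        \<le> norm ((indicator {a..b} r *\<^sub>R (r\<^sup>2 * f r)) * (1 / a\<^sup>2))"
      by simp
  qed
qed

text \<open>Both sides are the integral of q(r) p(t) over the region r \<le> t.\<close>

lemma Fubini_triangle:
  fixes p q :: "real \<Rightarrow> real"
  assumes p: "integrable lborel p" and q: "integrable lborel q"
  shows "(LBINT r. q r * (LBINT t:{r..}. p t)) = (LBINT t. p t * (LBINT r:{..t}. q r))"
proof -
  have [measurable]: "p \<in> borel_measurable borel" "q \<in> borel_measurable borel"
    using p q by auto
  define h where "h r t = (if r \<le> t then q r * p t else 0)" for r t
  have h1: "h r t = q r * (indicator {r..} t *\<^sub>R p t)" and h2: "h r t = p t * (indicator {..t} r *\<^sub>R q r)" for r t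
    by (auto simp: h_def indicator_def)
  have hm: "case_prod h \<in> borel_measurable (lborel \<Otimes>\<^sub>M lborel)"
    unfolding h_def by measurable
  have "integrable (lborel \<Otimes>\<^sub>M lborel) (case_prod h)"
  proof (rule lborel_pair.Fubini_integrable[OF hm])
    have hi: "integrable lborel (h r)" for r
      unfolding h1 using integrable_mult_indicator[OF _ p, of "{r..}"] by auto
    then show "AE r in lborel. integrable lborel (\<lambda>t. case (r, t) of (r, t) \<Rightarrow> h r t)"
      by simp
    show "integrable lborel (\<lambda>r. LBINT t. norm (case (r, t) of (r, t) \<Rightarrow> h r t))"
    proof (rule Bochner_Integration.integrable_bound)
      show "integrable lborel (\<lambda>r. norm (q r) * (LBINT t. norm (p t)))"
        using q by auto
      show "(\<lambda>r. LBINT t. norm (case (r, t) of (r, t) \<Rightarrow> h r t)) \<in> borel_measurable lborel"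
        using hm by measurable
      have "norm (LBINT t. norm (h r t)) \<le> norm (norm (q r) * (LBINT t. norm (p t)))" for r
      proof -
        have "(LBINT t. norm (h r t)) \<le> (LBINT t. norm (q r) * norm (p t))"
          by (rule integral_mono[OF integrable_norm[OF hi]])
              (use p in \<open>auto simp: h_def abs_mult\<close>)
        then show ?thesis
          by (simp add: Bochner_Integration.integral_nonneg)
      qed
      then show "AE r in lborel. norm (LBINT t. norm (case (r, t) of (r, t) \<Rightarrow> h r t))
          \<le> norm (norm (q r) * (LBINT t. norm (p t)))"
        by simp
    qed
  qed
  from lborel_pair.Fubini_integral[OF this]
  have "(LBINT r. LBINT t. h r t) = (LBINT t. LBINT r. h r t)"
    by simp
  moreover have "(LBINT r. LBINT t. h r t) = (LBINT r. q r * (LBINT t:{r..}. p t))"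
    unfolding h1 set_lebesgue_integral_def by simp
  moreover have "(LBINT t. LBINT r. h r t) = (LBINT t. p t * (LBINT r:{..t}. q r))"
    unfolding h2 set_lebesgue_integral_def by simp
  ultimately show ?thesis
    by simp
qed

lemma continuous_on_set_integral:
  fixes f :: "real \<Rightarrow> real"
  assumes "\<And>R. set_integrable lborel {0..R} f"
  shows "continuous_on {0<..} (\<lambda>x. LBINT y:{0..x}. f y)"
proof -
  have eq: "(\<lambda>x. LBINT y:{0..x}. f y) = (\<lambda>x. integral {0..x} f)"
    using set_borel_integral_eq_integral(2)[OF assms] by auto
  have "isCont (\<lambda>x. integral {0..x} f) x" if "x > 0" for x
  proof -
    have "continuous_on {0..x + 1} (\<lambda>x. integral {0..x} f)"
      by (intro indefinite_integral_continuous_1 set_borel_integral_eq_integral(1)[OF assms])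
    then show ?thesis
      using that by (intro continuous_on_interior) (auto simp: interior_atLeastAtMost_real)
  qed
  then show ?thesis
    unfolding eq by (intro continuous_at_imp_continuous_on) auto
qed

section \<open>Reduction of the weak Laplacian to an ordinary differential equation\<close>

text \<open>For \<psi>' = f / r^2 the Laplacian of \<psi>(|x|) is f' / r^2, and the weight r^2 of
  polar coordinates cancels the denominator. On the other side \<psi> is minus a tail integral of f
  / t^2, and exchanging the order of integration produces \<open>G\<close>.\<close>

lemma weak_laplacian_radial:
  assumes weak: "weak_laplacian (rad3 U) (rad3 F)"
  obtains u where "AE x in lborel. x > 0 \<longrightarrow> U x = u x"
    "\<forall>x>0. (u has_real_derivative (LBINT y:{0..x}. y\<^sup>2 * F y) / x\<^sup>2) (at x)"
proof -
  have U: "loc_integrable (rad3 U)" and F: "loc_integrable (rad3 F)"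
    using weak by (auto simp: weak_laplacian_def)
  then have [measurable]: "rad3 U \<in> borel_measurable borel" "rad3 F \<in> borel_measurable borel"
    by (auto simp: loc_integrable_def)
  define G where "G x = (LBINT y:{0..x}. y\<^sup>2 * F y)" for x
  have G: "continuous_on {0<..} G"
    unfolding G_def by (intro continuous_on_set_integral loc_integrable_rad3 F)
  have main: "(LBINT x. U x * deriv f x) = - (LBINT x. G x / x\<^sup>2 * f x)" if f: "test_half f" for f
  proof -
    obtain a b where ab: "0 < a" "a < b" "\<And>x. x < a \<Longrightarrow> f x = 0" "\<And>x. x > b \<Longrightarrow> f x = 0"
      "smooth_real f"
      using test_halfE[OF f] by metis
    \<comment> \<open>The exponent 3 makes r^2 \<psi>' = f, given \<psi>' = r \<kappa>.\<close>
    define \<kappa> where "\<kappa> r = f r / r ^ 3" for r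
    have \<kappa>: "test_half \<kappa>"
      unfolding \<kappa>_def by (rule test_half_divide[OF f])
    then have s\<kappa>: "smooth_real \<kappa>"
      by (simp add: test_half_def)
    define p where "p r = r * \<kappa> r" for r
    have p: "test_half p"
      using test_half_mult[OF \<kappa> smooth_id] by (simp add: p_def[abs_def] mult.commute)
    have cp: "continuous_on A p" for A
      using p by (simp add: test_half_def smooth_real_continuous)
    have p0: "p r = 0" if "r < a \<or> r > b" for r
      using that ab by (auto simp: p_def \<kappa>_def)
    obtain P where P: "\<And>r. (P has_real_derivative p r) (at r)"
      using antiderivative_UNIV[OF cp] by metis
    \<comment> \<open>The constant is fixed to the right of the support of \<open>p\<close>, so that
      \<psi> vanishes beyond b and is compactly supported as a radial function.\<close>
    define \<psi> where "\<psi> r = P r - P (b + 1)" for r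
    have D\<psi>: "(\<psi> has_real_derivative r * \<kappa> r) (at r)" for r
      using P[of r] unfolding \<psi>_def p_def by (auto intro!: derivative_eq_intros)
    have \<psi>0: "\<psi> r = 0" if "r > b" for r
    proof -
      have "\<exists>c. \<forall>r\<in>{b<..}. \<psi> r = c"
      proof (rule has_field_derivative_zero_constant)
        show "(\<psi> has_real_derivative 0) (at y within {b<..})" if "y \<in> {b<..}" for y
          using D\<psi>[of y] p0[of y] that ab(1,2) by (auto simp: has_field_derivative_at_within p_def)
      qed simp
      then have "\<psi> r = \<psi> (b + 1)"
        using that by fastforce
      then show ?thesis
        by (simp add: \<psi>_def)
    qed
    have \<psi>p: "\<psi> r = - (LBINT t:{r..}. p t)" for r
    proof (cases "r \<le> b + 1")
      case True
      have "(LBINT t. indicator {r..b + 1} t *\<^sub>R p t) = P (b + 1) - P r"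
        by (rule integral_FTC_Icc)
          (use True P cp in \<open>auto simp: has_real_derivative_iff_has_vector_derivative[symmetric]
            intro: has_field_derivative_at_within\<close>)
      moreover have "(LBINT t:{r..}. p t) = (LBINT t. indicator {r..b + 1} t *\<^sub>R p t)"
        unfolding set_lebesgue_integral_def
        by (rule Bochner_Integration.integral_cong) (auto simp: indicator_def p0)
      ultimately show ?thesis
        by (simp add: \<psi>_def)
    next
      case False
      have "(LBINT t:{r..}. p t) = (LBINT t::real. 0)"
        unfolding set_lebesgue_integral_def
        by (rule Bochner_Integration.integral_cong) (use False in \<open>auto simp: indicator_def p0\<close>)
      then show ?thesis
        using False \<psi>0 by simp
    qed
    have "continuous_on UNIV \<psi>"
      using D\<psi> DERIV_isCont by (blast intro: continuous_at_imp_continuous_on)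
    then have [measurable]: "\<psi> \<in> borel_measurable borel"
      by (rule borel_measurable_continuous_onI)
    have [measurable]: "\<kappa> \<in> borel_measurable borel" "deriv \<kappa> \<in> borel_measurable borel"
      using s\<kappa> by (auto intro: smooth_real_measurable smooth_real_deriv)
    have f_eq: "f r = r ^ 3 * \<kappa> r" for r
      using ab(1,3) by (auto simp: \<kappa>_def)
    \<comment> \<open>This is r^2 times the radial Laplacian 3 \<kappa> + r \<kappa>'.\<close>
    have f': "deriv f r = 3 * r\<^sup>2 * \<kappa> r + r ^ 3 * deriv \<kappa> r" for r
    proof (rule DERIV_imp_deriv)
      have "((\<lambda>r. r ^ 3 * \<kappa> r) has_real_derivative 3 * r\<^sup>2 * \<kappa> r + r ^ 3 * deriv \<kappa> r) (at r)"
        by (rule derivative_eq_intros smooth_real_DERIV[OF s\<kappa>] refl)+ simp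
      then show "(f has_real_derivative 3 * r\<^sup>2 * \<kappa> r + r ^ 3 * deriv \<kappa> r) (at r)"
        unfolding f_eq[abs_def] .
    qed
    have f'0: "deriv f r = 0" if "r < a" for r
      using deriv_eq_0[of "{..<a}" r f 0] that ab by auto
    have "(LBINT x. rad3 U x * laplacian (\<lambda>x::real^3. \<psi> (norm x)) x)
        = (LBINT x. rad3 (\<lambda>r. U r * (3 * \<kappa> r + r * deriv \<kappa> r)) x)"
      using laplacian_radial[where 'a = "real^3", OF \<kappa> D\<psi> \<psi>0] by (simp add: rad3_def)
    also have "\<dots> = sphere_area * (LBINT r:{0..}. r\<^sup>2 * (U r * (3 * \<kappa> r + r * deriv \<kappa> r)))"
    proof (rule integral_rad3)
      have "(\<lambda>x. rad3 U x * (3 * \<kappa> (norm x) + norm x * deriv \<kappa> (norm x))) \<in> borel_measurable borel"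
        by measurable
      then show "rad3 (\<lambda>r. U r * (3 * \<kappa> r + r * deriv \<kappa> r)) \<in> borel_measurable borel"
        by (simp add: rad3_def[abs_def])
    qed
    also have "(LBINT r:{0..}. r\<^sup>2 * (U r * (3 * \<kappa> r + r * deriv \<kappa> r))) = (LBINT r. U r * deriv f r)"
      unfolding set_lebesgue_integral_def
    proof (rule Bochner_Integration.integral_cong)
      fix r
      show "indicator {0..} r *\<^sub>R (r\<^sup>2 * (U r * (3 * \<kappa> r + r * deriv \<kappa> r))) = U r * deriv f r"
        using f'0[of r] ab(1)
        by (cases "r < 0") (auto simp: f' algebra_simps power2_eq_square power3_eq_cube)
    qed simp
    finally have L: "(LBINT x. rad3 U x * laplacian (\<lambda>x::real^3. \<psi> (norm x)) x)
        = sphere_area * (LBINT r. U r * deriv f r)" .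
    \<comment> \<open>The cut-off at b makes the density integrable and loses nothing, since \<psi>
      vanishes beyond b.\<close>
    define q where "q r = indicator {0..b} r *\<^sub>R (r\<^sup>2 * F r)" for r
    have q: "integrable lborel q"
      using loc_integrable_rad3[OF F, of b] by (simp add: set_integrable_def q_def[abs_def])
    have "(LBINT x. rad3 F x * \<psi> (norm x)) = (LBINT x. rad3 (\<lambda>r. F r * \<psi> r) x)"
      by (simp add: rad3_def)
    also have "\<dots> = sphere_area * (LBINT r:{0..}. r\<^sup>2 * (F r * \<psi> r))"
    proof (rule integral_rad3)
      have "(\<lambda>x. rad3 F x * \<psi> (norm x)) \<in> borel_measurable borel"
        by measurable
      then show "rad3 (\<lambda>r. F r * \<psi> r) \<in> borel_measurable borel"
        by (simp add: rad3_def[abs_def])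
    qed
    also have "(LBINT r:{0..}. r\<^sup>2 * (F r * \<psi> r)) = (LBINT r. - (q r * (LBINT t:{r..}. p t)))"
      unfolding set_lebesgue_integral_def[of lborel "{0..}" "\<lambda>r. r\<^sup>2 * (F r * \<psi> r)"]
    proof (rule Bochner_Integration.integral_cong)
      fix r
      have "indicator {0..} r *\<^sub>R (r\<^sup>2 * (F r * \<psi> r)) = q r * \<psi> r"
        using \<psi>0[of r] by (cases "r > b") (auto simp: q_def indicator_def)
      then show "indicator {0..} r *\<^sub>R (r\<^sup>2 * (F r * \<psi> r)) = - (q r * (LBINT t:{r..}. p t))"
        by (simp add: \<psi>p)
    qed simp
    also have "\<dots> = - (LBINT t. p t * (LBINT r:{..t}. q r))"
      using Fubini_triangle[OF test_half_integrable_self[OF p] q] by simp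
    also have "(LBINT t. p t * (LBINT r:{..t}. q r)) = (LBINT t. G t / t\<^sup>2 * f t)"
    proof (rule Bochner_Integration.integral_cong)
      fix t
      show "p t * (LBINT r:{..t}. q r) = G t / t\<^sup>2 * f t"
      proof (cases "t < a \<or> t > b")
        case True
        then show ?thesis
          using p0 ab by auto
      next
        case False
        have "(LBINT r:{..t}. q r) = G t"
          unfolding set_lebesgue_integral_def G_def
          by (rule Bochner_Integration.integral_cong) (use False in \<open>auto simp: q_def indicator_def\<close>)
        moreover have "p t = f t / t\<^sup>2"
          using False ab(1) by (simp add: p_def \<kappa>_def field_simps power2_eq_square power3_eq_cube)
        ultimately show ?thesis
          by simp
      qed
    qed simp
    finally have R: "(LBINT x. rad3 F x * \<psi> (norm x)) = sphere_area * (- (LBINT t. G t / t\<^sup>2 * f t))" .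
    have "(LBINT x. rad3 U x * laplacian (\<lambda>x::real^3. \<psi> (norm x)) x) = (LBINT x. rad3 F x * \<psi> (norm x))"
      using weak test_fun_radial[OF \<kappa> D\<psi> \<psi>0] unfolding weak_laplacian_def by blast
    then show ?thesis
      unfolding L R using sphere_area_pos by (metis mult_left_cancel order_less_irrefl)
  qed
  show ?thesis
    by (rule weak_derivative_half[of U "\<lambda>x. G x / x\<^sup>2"])
      (use main loc_integrable_rad3_away_0[OF U] that in
        \<open>auto simp: G_def[symmetric] intro!: continuous_intros G\<close>)
qed

section \<open>Asymptotics of the radial equations\<close>

text \<open>\<open>F\<close> may be singular at 0 and agrees with \<phi> only almost everywhere. The
  integral is split at x / 2, and the fundamental theorem is applied to \<phi> to the right of that
  point.\<close>

lemma DERIV_set_integral: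
  fixes F \<phi> :: "real \<Rightarrow> real"
  assumes F: "\<And>R. set_integrable lborel {0..R} F"
    and eq: "AE x in lborel. x > 0 \<longrightarrow> F x = \<phi> x"
    and \<phi>: "continuous_on {0<..} \<phi>" and x: "x > 0"
  shows "((\<lambda>x. LBINT y:{0..x}. F y) has_real_derivative \<phi> x) (at x)"
proof -
  define a where "a = x / 2"
  have a: "0 < a" "a < x"
    using x by (auto simp: a_def)
  have c: "continuous_on {a..b} \<phi>" for b
    by (rule continuous_on_subset[OF \<phi>]) (use a in auto)
  have i: "set_integrable lborel {a..b} \<phi>" for b
    using borel_integrable_compact[OF compact_Icc c[of b]] by (simp add: set_integrable_def)
  have G: "(LBINT y:{0..t}. F y) = (LBINT y:{0..a}. F y) + integral {a..t} \<phi>" if "t > a" for t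
  proof -
    have "(LBINT y:{0..a} \<union> {a<..t}. F y) = (LBINT y:{0..a}. F y) + (LBINT y:{a<..t}. F y)"
      by (rule set_integral_Un) (use a in \<open>auto intro!: F set_integrable_subset[OF F[of t]]\<close>)
    moreover have "{0..a} \<union> {a<..t} = {0..t}"
      using a that by auto
    moreover have "(LBINT y:{a<..t}. F y) = (LBINT y:{a..t}. \<phi> y)"
      unfolding set_lebesgue_integral_def
    proof (rule integral_cong_AE)
      have "set_integrable lborel {a<..t} F"
        by (rule set_integrable_subset[OF F[of t]]) (use a in auto)
      then show "(\<lambda>y. indicator {a<..t} y *\<^sub>R F y) \<in> borel_measurable lborel"
        by (simp add: set_integrable_def borel_measurable_integrable)
      show "(\<lambda>y. indicator {a..t} y *\<^sub>R \<phi> y) \<in> borel_measurable lborel"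
        using i[of t] by (simp add: set_integrable_def borel_measurable_integrable)
      show "AE y in lborel. indicator {a<..t} y *\<^sub>R F y = indicator {a..t} y *\<^sub>R \<phi> y"
        using eq AE_lborel_singleton[of a]
        by eventually_elim (use a in \<open>auto simp: indicator_def\<close>)
    qed
    ultimately show ?thesis
      using set_borel_integral_eq_integral(2)[OF i[of t]] by simp
  qed
  have "((\<lambda>t. integral {a..t} \<phi>) has_real_derivative \<phi> x) (at x within {a..x + 1})"
    by (rule integral_has_real_derivative[OF c]) (use a in auto)
  then have "((\<lambda>t. integral {a..t} \<phi>) has_real_derivative \<phi> x) (at x)"
    using a by (subst (asm) at_within_interior) (auto simp: interior_atLeastAtMost_real)
  then have "((\<lambda>t. (LBINT y:{0..a}. F y) + integral {a..t} \<phi>) has_real_derivative \<phi> x) (at x)"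
    by (auto intro!: derivative_eq_intros)
  then show ?thesis
  proof (rule has_field_derivative_transform_within_open[where S = "{a<..}"])
    show "(LBINT y:{0..a}. F y) + integral {a..t} \<phi> = (LBINT y:{0..t}. F y)" if "t \<in> {a<..}" for t
      using G[of t] that by simp
  qed (use a in auto)
qed

text \<open>
  Maximum principle for \<open>v = w - K e\<^bsup>-\<alpha>x\<^esup> - \<delta> e\<^bsup>\<alpha>x\<^esup>\<close>: at a positive interior maximum
  \<open>v'' \<ge> \<alpha>\<^sup>2 v > 0\<close>, which is absurd. The last term forces a positive maximum to be attained,
  and \<open>\<delta>\<close> is sent to \<open>0\<close> at the end.
\<close>

lemma exponential_upper_bound:
  fixes w w' c :: "real \<Rightarrow> real"
  assumes w: "\<And>x. x \<ge> R \<Longrightarrow> (w has_real_derivative w' x) (at x)"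
    and w': "\<And>x. x \<ge> R \<Longrightarrow> (w' has_real_derivative c x * w x) (at x)"
    and c: "\<And>x. x \<ge> R \<Longrightarrow> c x \<ge> \<alpha>\<^sup>2" and \<alpha>: "\<alpha> > 0"
    and growth: "\<And>\<delta>. \<delta> > 0 \<Longrightarrow> eventually (\<lambda>x. w x \<le> \<delta> * exp (\<alpha> * x)) at_top"
    and x: "x \<ge> R"
  shows "w x \<le> (\<bar>w R\<bar> * exp (\<alpha> * R)) * exp (- \<alpha> * x)"
proof -
  \<comment> \<open>Chosen so that K exp(-\<alpha> R) = |w R|, which makes the comparison function
    dominate \<open>w\<close> at the left endpoint.\<close>
  define K where "K = \<bar>w R\<bar> * exp (\<alpha> * R)"
  have "K \<ge> 0"
    by (simp add: K_def)
  have *: "w x \<le> K * exp (- \<alpha> * x) + \<delta> * exp (\<alpha> * x)" if \<delta>: "\<delta> > 0" for \<delta>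
  proof (rule ccontr)
    define v where "v x = w x - K * exp (- \<alpha> * x) - \<delta> * exp (\<alpha> * x)" for x
    define v' where "v' x = w' x + \<alpha> * K * exp (- \<alpha> * x) - \<alpha> * \<delta> * exp (\<alpha> * x)" for x
    have v: "(v has_real_derivative v' y) (at y)" if "y \<ge> R" for y
      unfolding v_def v'_def by (auto intro!: derivative_eq_intros w[OF that])
    have v': "(v' has_real_derivative c y * w y - \<alpha>\<^sup>2 * K * exp (- \<alpha> * y) - \<alpha>\<^sup>2 * \<delta> * exp (\<alpha> * y)) (at y)"
      if "y \<ge> R" for y
      unfolding v'_def by (auto intro!: derivative_eq_intros w'[OF that] simp: power2_eq_square)
    assume "\<not> ?thesis"
    then have vx: "v x > 0"
      by (simp add: v_def)
    have "K * exp (- \<alpha> * R) = \<bar>w R\<bar>"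
      by (simp add: K_def mult.assoc flip: exp_add)
    moreover have "\<delta> * exp (\<alpha> * R) > 0"
      using \<delta> by simp
    ultimately have vR: "v R < 0"
      by (simp add: v_def)
    \<comment> \<open>Half of \<delta> is spent here to make \<open>v\<close> strictly negative at
      the right endpoint.\<close>
    obtain X where X: "X > x" "w X \<le> \<delta> / 2 * exp (\<alpha> * X)"
      using eventually_conj[OF growth[of "\<delta> / 2"] eventually_gt_at_top[of x]] \<delta>
      by (auto simp: eventually_at_top_linorder)
    have "\<delta> / 2 * exp (\<alpha> * X) < \<delta> * exp (\<alpha> * X)" "K * exp (- \<alpha> * X) \<ge> 0"
      using \<delta> \<open>K \<ge> 0\<close> by auto
    with X(2) have vX: "v X < 0"
      by (simp add: v_def)
    have "continuous_on {R..X} v"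
      using v DERIV_isCont by (meson atLeastAtMost_iff continuous_at_imp_continuous_on)
    then obtain y where y: "y \<in> {R..X}" "\<And>t. t \<in> {R..X} \<Longrightarrow> v t \<le> v y"
      using continuous_attains_sup[of "{R..X}" v] x X(1) by auto
    have vy: "v y > 0"
      using y(2)[of x] vx x X(1) by auto
    then have "y \<noteq> R" "y \<noteq> X"
      using vR vX by auto
    with y(1) have yRX: "R < y" "y < X"
      by auto
    have "v' y = 0"
    proof (rule DERIV_local_max[OF v])
      show "0 < min (y - R) (X - y)"
        using yRX by simp
      show "\<forall>t. \<bar>y - t\<bar> < min (y - R) (X - y) \<longrightarrow> v t \<le> v y"
      proof (intro allI impI)
        fix t
        assume "\<bar>y - t\<bar> < min (y - R) (X - y)"
        then have "t \<in> {R..X}"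
          by (auto simp: abs_if split: if_splits)
        then show "v t \<le> v y"
          by (rule y(2))
      qed
    qed (use yRX in simp)
    \<comment> \<open>The lower bound for the coefficient \<open>c\<close> may be multiplied by
      \<open>w y\<close> only when this is positive.\<close>
    have "w y > 0"
      using vy \<open>K \<ge> 0\<close> \<delta> by (simp add: v_def) (smt (verit) exp_ge_zero mult_nonneg_nonneg)
    have "0 < \<alpha>\<^sup>2 * v y"
      using vy \<alpha> by simp
    also have "\<dots> \<le> c y * w y - \<alpha>\<^sup>2 * K * exp (- \<alpha> * y) - \<alpha>\<^sup>2 * \<delta> * exp (\<alpha> * y)"
      using mult_right_mono[OF c[of y], of "w y"] \<open>w y > 0\<close> yRX
      by (simp add: v_def algebra_simps)
    \<comment> \<open>With v' y = 0, a positive second derivative makes v' positive just to the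
      right of y, so \<open>v\<close> increases beyond its maximum.\<close>
    finally obtain d where d: "d > 0" "\<And>h. 0 < h \<Longrightarrow> h < d \<Longrightarrow> v' y < v' (y + h)"
      using DERIV_pos_inc_right[OF v'[of y]] yRX by auto
    define h where "h = min d (X - y) / 2"
    have h: "0 < h" "h < d" "y + h < X"
      using d(1) yRX by (auto simp: h_def min_def field_simps)
    obtain z where z: "y < z" "z < y + h" "v (y + h) - v y = (y + h - y) * v' z"
      using MVT2[of y "y + h" v v'] v h(1) yRX by auto
    have "v' z > 0"
      using d(2)[of "z - y"] z(1,2) h(2) \<open>v' y = 0\<close> by auto
    then have "v (y + h) > v y"
      using z(3) h(1) by (simp add: algebra_simps)
    moreover have "v (y + h) \<le> v y"
      using y(2)[of "y + h"] h yRX by auto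
    ultimately show False
      by simp
  qed
  \<comment> \<open>The point x is fixed, so the last term becomes an arbitrary e.\<close>
  have "w x \<le> K * exp (- \<alpha> * x) + e" if "e > 0" for e
    using *[of "e / exp (\<alpha> * x)"] that by simp
  then show ?thesis
    using field_le_epsilon K_def by blast
qed

text \<open>The equation is linear, so the one-sided bound applies to \<open>w\<close> and to -
  \<open>w\<close>.\<close>

lemma exponential_decay:
  fixes w w' c :: "real \<Rightarrow> real"
  assumes w: "\<And>x. x \<ge> R \<Longrightarrow> (w has_real_derivative w' x) (at x)"
    and w': "\<And>x. x \<ge> R \<Longrightarrow> (w' has_real_derivative c x * w x) (at x)"
    and c: "\<And>x. x \<ge> R \<Longrightarrow> c x \<ge> \<alpha>\<^sup>2" and \<alpha>: "\<alpha> > 0"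
    and growth: "((\<lambda>x. w x / exp (\<alpha> * x)) \<longlongrightarrow> 0) at_top"
    and x: "x \<ge> R"
  shows "\<bar>w x\<bar> \<le> (\<bar>w R\<bar> * exp (\<alpha> * R)) * exp (- \<alpha> * x)"
proof -
  have ev: "eventually (\<lambda>x. \<bar>w x\<bar> \<le> \<delta> * exp (\<alpha> * x)) at_top" if "\<delta> > 0" for \<delta>
    using tendstoD[OF growth that]
    by eventually_elim (simp add: abs_divide divide_less_eq less_imp_le)
  have "w x \<le> (\<bar>w R\<bar> * exp (\<alpha> * R)) * exp (- \<alpha> * x)"
    by (rule exponential_upper_bound[OF w w' c \<alpha> _ x])
      (auto intro: eventually_mono[OF ev])
  moreover have "- w x \<le> (\<bar>- w R\<bar> * exp (\<alpha> * R)) * exp (- \<alpha> * x)"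
  proof (rule exponential_upper_bound[where w' = "\<lambda>x. - w' x", OF _ _ c \<alpha> _ x])
    show "eventually (\<lambda>x. - w x \<le> \<delta> * exp (\<alpha> * x)) at_top" if "\<delta> > 0" for \<delta>
      by (rule eventually_mono[OF ev[OF that]]) auto
  qed (auto intro!: derivative_eq_intros w w')
  ultimately show ?thesis
    by (simp add: abs_le_iff)
qed

section \<open>The 1/x tail of solutions of x^2 z' = H\<close>

lemma nonneg_if_decreasing_to_0:
  fixes f f' :: "real \<Rightarrow> real"
  assumes "\<And>x. x \<ge> R \<Longrightarrow> (f has_real_derivative f' x) (at x)" "\<And>x. x \<ge> R \<Longrightarrow> f' x \<le> 0"
    and "(f \<longlongrightarrow> 0) at_top" and "x \<ge> R"
  shows "f x \<ge> 0"
proof (rule tendsto_upperbound[OF assms(3)])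
  have "f y \<le> f x" if "y \<ge> x" for y
    by (rule DERIV_nonpos_imp_nonincreasing[OF that]) (use assms in \<open>meson order_trans\<close>)
  then show "eventually (\<lambda>y. f y \<le> f x) at_top"
    using eventually_ge_at_top[of x] by (rule eventually_mono[rotated])
qed simp

text \<open>Where H is within e / 2 of M, \<open>z\<close> is compared with -(M + e/2) / x from
  below and -(M - e/2) / x from above. Each difference is monotone and tends to 0 at infinity, which
  fixes its sign.\<close>

lemma tendsto_times_if_DERIV_inverse_square:
  fixes z H :: "real \<Rightarrow> real"
  assumes z: "\<And>x. x > 0 \<Longrightarrow> (z has_real_derivative H x / x\<^sup>2) (at x)"
    and H: "(H \<longlongrightarrow> M) at_top" and z0: "(z \<longlongrightarrow> 0) at_top"
  shows "((\<lambda>x. x * z x) \<longlongrightarrow> - M) at_top"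
proof (rule tendstoI)
  fix e :: real
  assume "e > 0"
  then obtain R where R: "R > 0" "\<And>x. x \<ge> R \<Longrightarrow> \<bar>H x - M\<bar> \<le> e / 2"
    using eventually_conj[OF tendstoD[OF H, of "e / 2"] eventually_gt_at_top[of 0]]
    unfolding eventually_at_top_linorder dist_real_def by (metis half_gt_zero less_imp_le order_refl)
  have lim: "((\<lambda>x. \<sigma> * z x + C / x) \<longlongrightarrow> 0) at_top" for \<sigma> C
    using tendsto_add[OF tendsto_mult_right_zero[OF z0, of \<sigma>] tendsto_divide_0[OF tendsto_const[of C]
          filterlim_at_top_imp_at_infinity[OF filterlim_ident]]]
    by simp
  have D: "((\<lambda>x. \<sigma> * z x + C / x) has_real_derivative (\<sigma> * H x - C) / x\<^sup>2) (at x)"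
    if "x \<ge> R" for \<sigma> C x
    using that R(1)
    by (auto intro!: derivative_eq_intros z simp: power2_eq_square diff_divide_distrib)
  \<comment> \<open>The sign \<sigma> treats the two one-sided bounds together; it is taken to be 1
    and -1.\<close>
  have b: "\<sigma> * z x + C / x \<ge> 0" if "x \<ge> R" and "\<And>y. y \<ge> R \<Longrightarrow> \<sigma> * H y \<le> C" for x \<sigma> C
    by (rule nonneg_if_decreasing_to_0[OF D _ lim that(1)])
      (use that(2) in \<open>auto intro!: divide_nonpos_nonneg\<close>)
  have HM: "1 * H y \<le> M + e / 2" "- 1 * H y \<le> - M + e / 2" if "y \<ge> R" for y
    using R(2)[OF that] by linarith+
  have "\<bar>x * z x + M\<bar> \<le> e / 2" if "x \<ge> R" for x
  proof -
    have "1 * z x + (M + e / 2) / x \<ge> 0"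
      by (rule b[OF that HM(1)])
    moreover have "- 1 * z x + (- M + e / 2) / x \<ge> 0"
      by (rule b[OF that HM(2)])
    ultimately show ?thesis
      using that R(1) by (simp add: field_simps) (simp add: abs_if)
  qed
  with \<open>e > 0\<close> have "\<And>x. x \<ge> R \<Longrightarrow> dist (x * z x) (- M) < e"
    by (force simp: dist_real_def)
  then show "eventually (\<lambda>x. dist (x * z x) (- M) < e) at_top"
    using eventually_ge_at_top[of R] by (rule eventually_mono[rotated])
qed

section \<open>Essential limits under dilation and change of representative\<close>

text \<open>A dilation by a nonzero factor pulls null sets back to null sets.\<close>

lemma filterlim_ess_at_top_scale:
  assumes "c > 0"
  shows "filterlim (\<lambda>r. c * r) ess_at_top ess_at_top"
  unfolding filterlim_iff
proof (intro allI impI)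
  fix P :: "real \<Rightarrow> bool"
  assume "eventually P ess_at_top"
  then obtain N where "AE x in lborel. x \<ge> N \<longrightarrow> P x"
    by (auto simp: eventually_ess_at_top)
  \<comment> \<open>The exceptional set need not be Borel, so a Borel null set containing it is
    transported instead.\<close>
  then obtain A where A: "{x. \<not> (x \<ge> N \<longrightarrow> P x)} \<subseteq> A" "A \<in> null_sets lborel"
    by (auto elim!: AE_E simp: null_sets_def)
  then have "AE x in lborel. x \<notin> A"
    by (intro AE_not_in)
  then have "AE r in lborel. 0 + c * r \<notin> A"
    using A(2) assms by (intro AE_borel_affine[where P = "\<lambda>x. x \<notin> A"]) (auto simp: null_sets_def)
  then have "AE r in lborel. r \<ge> N / c \<longrightarrow> P (c * r)"
  proof eventually_elim
    case (elim r)
    then show ?case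
      using A(1) assms by (auto simp: field_simps)
  qed
  then show "eventually (\<lambda>r. P (c * r)) ess_at_top"
    by (auto simp: eventually_ess_at_top)
qed

lemma tendsto_ess_at_top_AE_cong:
  assumes eq: "AE x in lborel. x > 0 \<longrightarrow> f x = g x"
  shows "(f \<longlongrightarrow> l) ess_at_top \<longleftrightarrow> (g \<longlongrightarrow> l) ess_at_top"
proof (rule tendsto_cong)
  have "AE x in lborel. x \<ge> 1 \<longrightarrow> f x = g x"
    using eq by eventually_elim auto
  then show "eventually (\<lambda>x. f x = g x) ess_at_top"
    by (auto simp: eventually_ess_at_top)
qed

section \<open>The system\<close>

lemma loc_integrable_cmult: "loc_integrable u \<Longrightarrow> loc_integrable (\<lambda>x. c * u x)"
  unfolding loc_integrable_def by (auto intro!: set_integrable_mult_right)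

lemma weak_partial_cmult: "weak_partial b u g \<Longrightarrow> weak_partial b (\<lambda>x. c * u x) (\<lambda>x. c * g x)"
  unfolding weak_partial_def by (auto intro: loc_integrable_cmult simp: mult.assoc)

lemma weak_laplacian_cmult: "weak_laplacian u f \<Longrightarrow> weak_laplacian (\<lambda>x. c * u x) (\<lambda>x. c * f x)"
  unfolding weak_laplacian_def by (auto intro: loc_integrable_cmult simp: mult.assoc)

lemma Lp_cmult: "u \<in> Lp p \<Longrightarrow> (\<lambda>x. c * u x) \<in> Lp p"
  by (auto simp: Lp_def abs_mult power_mult_distrib)

lemma L2_gradient_cmult:
  assumes "L2_gradient u"
  shows "L2_gradient (\<lambda>x. c * u x)"
  unfolding L2_gradient_def
proof
  fix b :: 'a
  assume "b \<in> Basis"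
  then obtain g where "g \<in> Lp 2" "weak_partial b u g"
    using assms unfolding L2_gradient_def by blast
  then show "\<exists>g\<in>Lp 2. weak_partial b (\<lambda>x. c * u x) g"
    using Lp_cmult weak_partial_cmult by blast
qed

lemma H1r_cmult:
  assumes "T \<in> H1r"
  shows "(\<lambda>\<xi>. c * T \<xi>) \<in> H1r"
proof -
  have "rad3 (\<lambda>\<xi>. c * T \<xi>) = (\<lambda>x. c * rad3 T x)"
    by (simp add: rad3_def[abs_def])
  with assms show ?thesis
    by (simp add: H1r_def Lp_cmult L2_gradient_cmult)
qed

text \<open>The first equation is linear in the first unknown; in the second, \<mu> T^2 = (\<mu> /
  c^2) (c T)^2.\<close>

lemma solution_cmult:
  assumes "solution \<mu> T Y" and "c \<noteq> 0"
  shows "solution (\<mu> / c\<^sup>2) (\<lambda>\<xi>. c * T \<xi>) Y"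
proof -
  have "rad3 (\<lambda>\<xi>. c * T \<xi>) = (\<lambda>x. c * rad3 T x)"
    "rad3 (\<lambda>\<xi>. c * T \<xi> + c * T \<xi> * Y \<xi>) = (\<lambda>x. c * rad3 (\<lambda>\<xi>. T \<xi> + T \<xi> * Y \<xi>) x)"
    by (auto simp: rad3_def algebra_simps)
  then have "weak_laplacian (rad3 (\<lambda>\<xi>. c * T \<xi>)) (rad3 (\<lambda>\<xi>. c * T \<xi> + c * T \<xi> * Y \<xi>))"
    using assms(1) by (simp add: solution_def weak_laplacian_cmult)
  moreover have "((\<lambda>\<xi>. c * T \<xi>) \<longlongrightarrow> 0) ess_at_top"
    using assms(1) by (auto simp: solution_def intro: tendsto_mult_right_zero)
  ultimately show ?thesis
    using assms H1r_cmult by (simp add: solution_def power_mult_distrib)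
qed

lemma solution_scale_iff:
  assumes "\<mu> > 0"
  shows "solution \<mu> T Y \<longleftrightarrow> solution 1 (\<lambda>\<xi>. sqrt \<mu> * T \<xi>) Y"
proof
  assume "solution \<mu> T Y"
  then show "solution 1 (\<lambda>\<xi>. sqrt \<mu> * T \<xi>) Y"
    using solution_cmult[of \<mu> T Y "sqrt \<mu>"] assms by simp
next
  assume "solution 1 (\<lambda>\<xi>. sqrt \<mu> * T \<xi>) Y"
  then show "solution \<mu> T Y"
    using solution_cmult[of 1 "\<lambda>\<xi>. sqrt \<mu> * T \<xi>" Y "1 / sqrt \<mu>"] assms
    by (simp add: power_divide)
qed

section \<open>Classical representatives and their asymptotics\<close>

text \<open>The representatives are continuous away from the origin, so the essential limits at
  infinity become ordinary ones. The integrals keep the given \<open>S\<close> and \<open>Z\<close>,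
  since null sets do not affect them.\<close>

lemma solution_classical:
  assumes "solution \<mu> S Z"
  obtains s z where
    "AE x in lborel. x > 0 \<longrightarrow> S x = s x" "AE x in lborel. x > 0 \<longrightarrow> Z x = z x"
    "\<forall>x>0. (s has_real_derivative (LBINT y:{0..x}. y\<^sup>2 * (S y + S y * Z y)) / x\<^sup>2) (at x)"
    "\<forall>x>0. (z has_real_derivative (LBINT y:{0..x}. y\<^sup>2 * (\<mu> * (S y)\<^sup>2)) / x\<^sup>2) (at x)"
    "(s \<longlongrightarrow> 0) at_top" "(z \<longlongrightarrow> 0) at_top"
    "continuous_on {0<..} s" "continuous_on {0<..} z"
proof -
  have S: "weak_laplacian (rad3 S) (rad3 (\<lambda>\<xi>. S \<xi> + S \<xi> * Z \<xi>))"
    and Z: "weak_laplacian (rad3 Z) (rad3 (\<lambda>\<xi>. \<mu> * (S \<xi>)\<^sup>2))"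
    and lim: "(S \<longlongrightarrow> 0) ess_at_top" "(Z \<longlongrightarrow> 0) ess_at_top"
    using assms unfolding solution_def by simp_all
  obtain s where s: "AE x in lborel. x > 0 \<longrightarrow> S x = s x"
    "\<forall>x>0. (s has_real_derivative (LBINT y:{0..x}. y\<^sup>2 * (S y + S y * Z y)) / x\<^sup>2) (at x)"
    using weak_laplacian_radial[OF S] by blast
  obtain z where z: "AE x in lborel. x > 0 \<longrightarrow> Z x = z x"
    "\<forall>x>0. (z has_real_derivative (LBINT y:{0..x}. y\<^sup>2 * (\<mu> * (S y)\<^sup>2)) / x\<^sup>2) (at x)"
    using weak_laplacian_radial[OF Z] by blast
  have c: "continuous_on {0<..} s" "continuous_on {0<..} z"
    using s(2) z(2) by (auto intro!: continuous_at_imp_continuous_on DERIV_isCont)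
  have "(s \<longlongrightarrow> 0) at_top" "(z \<longlongrightarrow> 0) at_top"
    using lim tendsto_ess_at_top_AE_cong[OF s(1)] tendsto_ess_at_top_AE_cong[OF z(1)]
      tendsto_ess_at_top_iff[OF c(1)] tendsto_ess_at_top_iff[OF c(2)] by simp_all
  from that[OF s(1) z(1) s(2) z(2) this c] show ?thesis .
qed

lemma solution_exponential_decay:
  assumes sol: "solution \<mu> S Z" and \<alpha>: "0 < \<alpha>" "\<alpha> < 1"
  obtains K where "eventually (\<lambda>x. \<bar>S x\<bar> \<le> K * exp (- \<alpha> * x)) ess_at_top"
proof -
  obtain s z where AE: "AE x in lborel. x > 0 \<longrightarrow> S x = s x" "AE x in lborel. x > 0 \<longrightarrow> Z x = z x"
    and s: "\<forall>x>0. (s has_real_derivative (LBINT y:{0..x}. y\<^sup>2 * (S y + S y * Z y)) / x\<^sup>2) (at x)"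
    and "\<forall>x>0. (z has_real_derivative (LBINT y:{0..x}. y\<^sup>2 * (\<mu> * (S y)\<^sup>2)) / x\<^sup>2) (at x)"
    and lim: "(s \<longlongrightarrow> 0) at_top" "(z \<longlongrightarrow> 0) at_top"
    and c: "continuous_on {0<..} s" "continuous_on {0<..} z"
    using solution_classical[OF sol] by blast
  define F where "F y = y\<^sup>2 * (S y + S y * Z y)" for y
  define G where "G x = (LBINT y:{0..x}. F y)" for x
  have F: "set_integrable lborel {0..R} F" for R
    using sol unfolding F_def
    by (intro loc_integrable_rad3) (auto simp: solution_def weak_laplacian_def)
  have AEF: "AE y in lborel. y > 0 \<longrightarrow> F y = y\<^sup>2 * (s y * (1 + z y))"
    using AE by eventually_elim (auto simp: F_def algebra_simps)
  have G: "(G has_real_derivative x\<^sup>2 * (s x * (1 + z x))) (at x)" if "x > 0" for x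
    unfolding G_def by (rule DERIV_set_integral[OF F AEF _ that]) (intro continuous_intros c)
  have s': "(s has_real_derivative G x / x\<^sup>2) (at x)" if "x > 0" for x
    using s that by (simp add: G_def F_def)
  define w where "w x = x * s x" for x
  \<comment> \<open>This is s + x s' with s' = G / x^2.\<close>
  define w' where "w' x = s x + G x / x" for x
  have w: "(w has_real_derivative w' x) (at x)" if "x > 0" for x
    unfolding w_def w'_def
    by (rule DERIV_cong[OF DERIV_mult[OF DERIV_ident s'[OF that]]])
      (use that in \<open>simp add: power2_eq_square\<close>)
  \<comment> \<open>The term G / x^2 coming from s' cancels against the one from the derivative of G
    / x.\<close>
  have w': "(w' has_real_derivative (1 + z x) * w x) (at x)" if "x > 0" for x
    unfolding w_def w'_def
    by (rule DERIV_cong[OF DERIV_add[OF s'[OF that] DERIV_divide[OF G[OF that] DERIV_ident]]])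
      (use that in \<open>auto simp: field_simps power2_eq_square\<close>)
  have "\<alpha>\<^sup>2 < 1"
    using \<alpha> by (simp add: power_less_one_iff)
  then have "eventually (\<lambda>x. dist (z x) 0 < 1 - \<alpha>\<^sup>2) at_top"
    by (intro tendstoD[OF lim(2)]) simp
  \<comment> \<open>Besides 1 + z \<ge> \<alpha>^2, the threshold ensures x \<ge> 1, which keeps the
    equations away from the origin and later gives |s| \<le> |w|.\<close>
  then have "eventually (\<lambda>x. dist (z x) 0 < 1 - \<alpha>\<^sup>2 \<and> x \<ge> 1) at_top"
    by (intro eventually_conj eventually_ge_at_top)
  then obtain R where R: "\<And>x. x \<ge> R \<Longrightarrow> dist (z x) 0 < 1 - \<alpha>\<^sup>2 \<and> x \<ge> 1"
    by (auto simp: eventually_at_top_linorder)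
  \<comment> \<open>The growth condition holds because \<open>s\<close> tends to 0 and x /
    exp(\<alpha> x) does too.\<close>
  have growth: "((\<lambda>x. w x / exp (\<alpha> * x)) \<longlongrightarrow> 0) at_top"
  proof -
    have "filterlim (\<lambda>x. \<alpha> * x) at_top at_top"
      using \<alpha> by (intro filterlim_tendsto_pos_mult_at_top[OF tendsto_const] filterlim_ident)
    from filterlim_compose[OF tendsto_power_div_exp_0[of 1] this]
    have e: "((\<lambda>x. (\<alpha> * x) / exp (\<alpha> * x)) \<longlongrightarrow> 0) at_top"
      by simp
    have "((\<lambda>x. s x * ((\<alpha> * x) / exp (\<alpha> * x))) \<longlongrightarrow> 0 * 0) at_top"
      by (rule tendsto_mult[OF lim(1) e])
    from tendsto_mult[OF tendsto_const[of "1 / \<alpha>"] this]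
    have "((\<lambda>x. 1 / \<alpha> * (s x * ((\<alpha> * x) / exp (\<alpha> * x)))) \<longlongrightarrow> 0) at_top"
      by simp
    then show ?thesis
      using \<alpha> by (simp add: w_def mult.commute)
  qed
  define K where "K = \<bar>w R\<bar> * exp (\<alpha> * R)"
  have wK: "\<bar>w x\<bar> \<le> K * exp (- \<alpha> * x)" if "x \<ge> R" for x
    unfolding K_def
  proof (rule exponential_decay[where w' = w' and c = "\<lambda>x. 1 + z x", OF _ _ _ \<alpha>(1) growth that])
    fix y
    assume "y \<ge> R"
    with R have y: "dist (z y) 0 < 1 - \<alpha>\<^sup>2" "y \<ge> 1"
      by auto
    then show "\<alpha>\<^sup>2 \<le> 1 + z y" "(w has_real_derivative w' y) (at y)"
      "(w' has_real_derivative (1 + z y) * w y) (at y)"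
      using w w' by (auto simp: dist_real_def)
  qed
  have "AE x in lborel. x \<ge> R \<longrightarrow> \<bar>S x\<bar> \<le> K * exp (- \<alpha> * x)"
    using AE(1)
  proof eventually_elim
    case (elim x)
    show ?case
    proof
      assume "x \<ge> R"
      with R have "x \<ge> 1"
        by auto
      then have "\<bar>s x\<bar> \<le> \<bar>w x\<bar>"
        by (simp add: w_def abs_mult mult_left_le mult_right_mono[of 1 x "\<bar>s x\<bar>", simplified])
      then show "\<bar>S x\<bar> \<le> K * exp (- \<alpha> * x)"
        using wK[OF \<open>x \<ge> R\<close>] elim \<open>x \<ge> 1\<close> by simp
    qed
  qed
  then show ?thesis
    by (intro that[of K]) (auto simp: eventually_ess_at_top)
qed

text \<open>Square-integrability of \<open>S\<close> on R^3 means, in polar coordinates, that y^2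
  S^2 is integrable on the half-line, so x^2 z' has a finite limit.\<close>

lemma solution_Z_asymptotics:
  assumes sol: "solution \<mu> S Z"
  shows "((\<lambda>x. x * Z x) \<longlongrightarrow> - (\<mu> * (LBINT y:{0..}. y\<^sup>2 * (S y)\<^sup>2))) ess_at_top"
proof -
  obtain s z where "AE x in lborel. x > 0 \<longrightarrow> S x = s x"
    and AE: "AE x in lborel. x > 0 \<longrightarrow> Z x = z x"
    and "\<forall>x>0. (s has_real_derivative (LBINT y:{0..x}. y\<^sup>2 * (S y + S y * Z y)) / x\<^sup>2) (at x)"
    and z: "\<forall>x>0. (z has_real_derivative (LBINT y:{0..x}. y\<^sup>2 * (\<mu> * (S y)\<^sup>2)) / x\<^sup>2) (at x)"
    and "(s \<longlongrightarrow> 0) at_top" and lim: "(z \<longlongrightarrow> 0) at_top"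
    and "continuous_on {0<..} s" "continuous_on {0<..} z"
    using solution_classical[OF sol] by blast
  have L2: "rad3 S \<in> borel_measurable borel" "integrable lborel (\<lambda>x. \<bar>rad3 S x\<bar> ^ 2)"
    using sol by (auto simp: solution_def H1r_def Lp_def)
  have "rad3 (\<lambda>y. (S y)\<^sup>2) = (\<lambda>x. \<bar>rad3 S x\<bar> ^ 2)"
    by (simp add: rad3_def[abs_def])
  then have "set_integrable lborel {0..} (\<lambda>y. y\<^sup>2 * (S y)\<^sup>2)"
    using integrable_rad3[of "\<lambda>y. (S y)\<^sup>2"] L2 by auto
  then have "((\<lambda>x. LBINT y:{0..x}. y\<^sup>2 * (S y)\<^sup>2) \<longlongrightarrow> (LBINT y:{0..}. y\<^sup>2 * (S y)\<^sup>2)) at_top"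
    by (intro tendsto_set_lebesgue_integral_at_top) auto
  then have "((\<lambda>x. \<mu> * (LBINT y:{0..x}. y\<^sup>2 * (S y)\<^sup>2)) \<longlongrightarrow> \<mu> * (LBINT y:{0..}. y\<^sup>2 * (S y)\<^sup>2)) at_top"
    by (intro tendsto_intros)
  moreover have "(LBINT y:{0..x}. y\<^sup>2 * (\<mu> * (S y)\<^sup>2)) = \<mu> * (LBINT y:{0..x}. y\<^sup>2 * (S y)\<^sup>2)" for x
    by (subst set_integral_mult_right[symmetric]) (simp add: mult_ac)
  ultimately have "((\<lambda>x. x * z x) \<longlongrightarrow> - (\<mu> * (LBINT y:{0..}. y\<^sup>2 * (S y)\<^sup>2))) at_top"
    using z by (intro tendsto_times_if_DERIV_inverse_square[OF _ _ lim]) auto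
  then have "((\<lambda>x. x * z x) \<longlongrightarrow> - (\<mu> * (LBINT y:{0..}. y\<^sup>2 * (S y)\<^sup>2))) ess_at_top"
    unfolding ess_at_top_def by (rule tendsto_mono[OF inf_le1])
  moreover have eq: "AE x in lborel. x > 0 \<longrightarrow> x * Z x = x * z x"
    using AE by eventually_elim auto
  ultimately show ?thesis
    by (simp only: tendsto_ess_at_top_AE_cong[OF eq])
qed

theorem theorem3:
  fixes \<mu> m \<epsilon> :: real and S Z :: "real \<Rightarrow> real"
  assumes "\<mu> > 0" and "m > 0" and "\<epsilon> > 0"
    and "solution \<mu> S Z"
  shows "(\<forall>\<alpha><1. (\<lambda>r. S (\<epsilon> * m * r)) \<in> O[ess_at_top](\<lambda>r. exp (- (\<alpha> * \<epsilon> * m * r))))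
    \<and> ((\<lambda>r. r * Z (\<epsilon> * m * r)) \<longlongrightarrow>
          - (\<mu> * (LBINT y:{0..}. y\<^sup>2 * (S y)\<^sup>2)) / (\<epsilon> * m)) ess_at_top
    \<and> (\<forall>T Y. solution \<mu> T Y \<longleftrightarrow> solution 1 (\<lambda>\<xi>. sqrt \<mu> * T \<xi>) Y)"
proof (intro conjI allI impI)
  define c where "c = \<epsilon> * m"
  have "c > 0"
    using assms by (simp add: c_def)
  note scale = filterlim_ess_at_top_scale[OF this]
  fix \<alpha> :: real
  assume "\<alpha> < 1"
  \<comment> \<open>The decay estimate needs a positive exponent, whereas \<alpha> may be zero or
    negative. The larger exponent \<beta> gives a stronger bound for r \<ge> 0.\<close>
  define \<beta> where "\<beta> = max \<alpha> (1 / 2)"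
  have \<beta>: "0 < \<beta>" "\<beta> < 1" "\<alpha> \<le> \<beta>"
    using \<open>\<alpha> < 1\<close> by (auto simp: \<beta>_def)
  obtain K where K: "eventually (\<lambda>x. \<bar>S x\<bar> \<le> K * exp (- \<beta> * x)) ess_at_top"
    using solution_exponential_decay[OF assms(4) \<beta>(1,2)] by blast
  have "eventually (\<lambda>r. r \<ge> 0) ess_at_top"
    unfolding ess_at_top_def by (rule filter_leD[OF inf_le1 eventually_ge_at_top])
  moreover have "eventually (\<lambda>r. \<bar>S (c * r)\<bar> \<le> K * exp (- \<beta> * (c * r))) ess_at_top"
    using scale K by (auto simp: filterlim_iff)
  ultimately have "eventually (\<lambda>r. norm (S (c * r)) \<le> \<bar>K\<bar> * norm (exp (- (\<alpha> * c * r)))) ess_at_top"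
  proof eventually_elim
    case (elim r)
    have "\<alpha> * (c * r) \<le> \<beta> * (c * r)"
      using \<beta>(3) elim(1) \<open>c > 0\<close> by (intro mult_right_mono) auto
    \<comment> \<open>No sign of \<open>K\<close> is known, hence the absolute value.\<close>
    then have "K * exp (- \<beta> * (c * r)) \<le> \<bar>K\<bar> * exp (- (\<alpha> * c * r))"
      by (intro mult_mono) (auto simp: mult.assoc)
    with elim(2) show ?case
      by simp
  qed
  then show "(\<lambda>r. S (\<epsilon> * m * r)) \<in> O[ess_at_top](\<lambda>r. exp (- (\<alpha> * \<epsilon> * m * r)))"
    by (intro bigoI[of _ "\<bar>K\<bar>"]) (simp add: c_def mult.assoc)
next
  define c where "c = \<epsilon> * m"
  have "c > 0"
    using assms by (simp add: c_def)
  \<comment> \<open>The limit of x Z(x) is taken along x = c r and divided by c.\<close>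
  have "((\<lambda>r. c * r * Z (c * r) / c) \<longlongrightarrow> - (\<mu> * (LBINT y:{0..}. y\<^sup>2 * (S y)\<^sup>2)) / c) ess_at_top"
    by (intro tendsto_divide tendsto_const
        filterlim_compose[OF solution_Z_asymptotics[OF assms(4)] filterlim_ess_at_top_scale])
      (use \<open>c > 0\<close> in auto)
  moreover have "c * r * Z (c * r) / c = r * Z (c * r)" for r
    using \<open>c > 0\<close> by simp
  ultimately show "((\<lambda>r. r * Z (\<epsilon> * m * r)) \<longlongrightarrow>
      - (\<mu> * (LBINT y:{0..}. y\<^sup>2 * (S y)\<^sup>2)) / (\<epsilon> * m)) ess_at_top"
    by (simp only: c_def)
next
  show "solution \<mu> T Y \<longleftrightarrow> solution 1 (\<lambda>\<xi>. sqrt \<mu> * T \<xi>) Y" for T Y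
    by (rule solution_scale_iff[OF assms(1)])
qed

end
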